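(* The theory $\mathsf{RCA}_0$ proves that $\mathsf{RT}^3_2$ implies $\mathsf{ACA}_0$.
   Context: $\mathsf{RCA}_0$ is the usual base system of Reverse Mathematics. $\mathsf{ACA}_0$ is $\mathsf{RCA}_0$ together with $\forall X\,\exists Y\,(Y=X')$, i.e. the Turing jump of every set exists; "implies $\mathsf{ACA}_0$" over $\mathsf{RCA}_0$ means implying this axiom. $\mathsf{RT}^3_2$ is the statement: for every colouring $C:[\mathbb{N}]^3\to\{0,1\}$ of the 3-element subsets of $\mathbb{N}$ there is an infinite set $H\subseteq\mathbb{N}$ such that $C$ is constant on $[H]^3$. *)

theory Defs
  imports Main
begin

section \<open>The language of second-order arithmetic\<close>

text \<open>
  Two-sorted first-order language with number variables and set variables. Both sorts use
  de Bruijn indices, counted separately: a number quantifier binds number index 0 and leaves the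
  set indices alone, and conversely. Equality is primitive on numbers only; there are no
  compound set terms.
\<close>

datatype tm =
    Var nat
  | Zero ("\<^bold>0")
  | One ("\<^bold>1")
  | Add tm tm (infixl "\<^bold>+" 65)
  | Mul tm tm (infixl "\<^bold>*" 70)

datatype fm =
    Eq tm tm (infix "\<^bold>=" 50)
  | Lt tm tm (infix "\<^bold><" 50)
  | In tm nat (infix "\<^bold>\<in>" 50)
  | Neg fm ("\<^bold>\<not> _" [40] 40)
  | Imp fm fm (infixr "\<^bold>\<longrightarrow>" 25)
  | All fm
  | AllS fm

abbreviation And :: "fm \<Rightarrow> fm \<Rightarrow> fm" (infixr "\<^bold>\<and>" 35) where
  "\<phi> \<^bold>\<and> \<psi> \<equiv> \<^bold>\<not> (\<phi> \<^bold>\<longrightarrow> \<^bold>\<not> \<psi>)"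

abbreviation Or :: "fm \<Rightarrow> fm \<Rightarrow> fm" (infixr "\<^bold>\<or>" 30) where
  "\<phi> \<^bold>\<or> \<psi> \<equiv> \<^bold>\<not> \<phi> \<^bold>\<longrightarrow> \<psi>"

abbreviation Iff :: "fm \<Rightarrow> fm \<Rightarrow> fm" (infixr "\<^bold>\<longleftrightarrow>" 25) where
  "\<phi> \<^bold>\<longleftrightarrow> \<psi> \<equiv> (\<phi> \<^bold>\<longrightarrow> \<psi>) \<^bold>\<and> (\<psi> \<^bold>\<longrightarrow> \<phi>)"

abbreviation Ex :: "fm \<Rightarrow> fm" where
  "Ex \<phi> \<equiv> \<^bold>\<not> All (\<^bold>\<not> \<phi>)"

abbreviation ExS :: "fm \<Rightarrow> fm" where
  "ExS \<phi> \<equiv> \<^bold>\<not> AllS (\<^bold>\<not> \<phi>)"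

primrec substt :: "(nat \<Rightarrow> tm) \<Rightarrow> tm \<Rightarrow> tm" where
  "substt \<sigma> (Var i) = \<sigma> i"
| "substt \<sigma> \<^bold>0 = \<^bold>0"
| "substt \<sigma> \<^bold>1 = \<^bold>1"
| "substt \<sigma> (s \<^bold>+ t) = substt \<sigma> s \<^bold>+ substt \<sigma> t"
| "substt \<sigma> (s \<^bold>* t) = substt \<sigma> s \<^bold>* substt \<sigma> t"

text \<open>\<open>lift m t\<close> is the term \<open>t\<close> moved under \<open>m\<close> further number quantifiers.\<close>

definition lift :: "nat \<Rightarrow> tm \<Rightarrow> tm" where
  "lift m = substt (\<lambda>i. Var (i + m))"

text \<open>Simultaneous capture-avoiding substitution of terms for number variables and of set
  variables for set variables.\<close>

primrec subst :: "(nat \<Rightarrow> tm) \<Rightarrow> (nat \<Rightarrow> nat) \<Rightarrow> fm \<Rightarrow> fm" where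
  "subst \<sigma> \<rho> (s \<^bold>= t) = (substt \<sigma> s \<^bold>= substt \<sigma> t)"
| "subst \<sigma> \<rho> (s \<^bold>< t) = (substt \<sigma> s \<^bold>< substt \<sigma> t)"
| "subst \<sigma> \<rho> (t \<^bold>\<in> X) = (substt \<sigma> t \<^bold>\<in> \<rho> X)"
| "subst \<sigma> \<rho> (\<^bold>\<not> \<phi>) = (\<^bold>\<not> subst \<sigma> \<rho> \<phi>)"
| "subst \<sigma> \<rho> (\<phi> \<^bold>\<longrightarrow> \<psi>) = (subst \<sigma> \<rho> \<phi> \<^bold>\<longrightarrow> subst \<sigma> \<rho> \<psi>)"
| "subst \<sigma> \<rho> (All \<phi>) = All (subst (case_nat (Var 0) (\<lambda>i. lift 1 (\<sigma> i))) \<rho> \<phi>)"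
| "subst \<sigma> \<rho> (AllS \<phi>) = AllS (subst \<sigma> (case_nat 0 (\<lambda>i. Suc (\<rho> i))) \<phi>)"

definition inst :: "tm \<Rightarrow> fm \<Rightarrow> fm" where
  "inst t = subst (case_nat t Var) (\<lambda>X. X)"

definition instS :: "nat \<Rightarrow> fm \<Rightarrow> fm" where
  "instS Y = subst Var (case_nat Y (\<lambda>X. X))"

definition lift_fm :: "fm \<Rightarrow> fm" where
  "lift_fm = subst (\<lambda>i. Var (Suc i)) (\<lambda>X. X)"

definition liftS_fm :: "fm \<Rightarrow> fm" where
  "liftS_fm = subst Var Suc"

section \<open>Provability\<close>

text \<open>
  A Hilbert calculus for two-sorted classical first-order logic with equality. Because of the
  generalisation rules, an open formula in \<open>T\<close> has the force of its universal closure.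
\<close>

inductive provable :: "fm set \<Rightarrow> fm \<Rightarrow> bool" (infix "\<turnstile>" 20) for T :: "fm set" where
  Axiom: "\<phi> \<in> T \<Longrightarrow> T \<turnstile> \<phi>"
| K: "T \<turnstile> \<phi> \<^bold>\<longrightarrow> \<psi> \<^bold>\<longrightarrow> \<phi>"
| S: "T \<turnstile> (\<phi> \<^bold>\<longrightarrow> \<psi> \<^bold>\<longrightarrow> \<chi>) \<^bold>\<longrightarrow> (\<phi> \<^bold>\<longrightarrow> \<psi>) \<^bold>\<longrightarrow> \<phi> \<^bold>\<longrightarrow> \<chi>"
| Contra: "T \<turnstile> (\<^bold>\<not> \<phi> \<^bold>\<longrightarrow> \<^bold>\<not> \<psi>) \<^bold>\<longrightarrow> (\<^bold>\<not> \<phi> \<^bold>\<longrightarrow> \<psi>) \<^bold>\<longrightarrow> \<phi>"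
| All_inst: "T \<turnstile> All \<phi> \<^bold>\<longrightarrow> inst t \<phi>"
| All_dist: "T \<turnstile> All (lift_fm \<phi> \<^bold>\<longrightarrow> \<psi>) \<^bold>\<longrightarrow> \<phi> \<^bold>\<longrightarrow> All \<psi>"
| AllS_inst: "T \<turnstile> AllS \<phi> \<^bold>\<longrightarrow> instS X \<phi>"
| AllS_dist: "T \<turnstile> AllS (liftS_fm \<phi> \<^bold>\<longrightarrow> \<psi>) \<^bold>\<longrightarrow> \<phi> \<^bold>\<longrightarrow> AllS \<psi>"
| Refl: "T \<turnstile> t \<^bold>= t"
| Leibniz: "T \<turnstile> s \<^bold>= t \<^bold>\<longrightarrow> inst s \<phi> \<^bold>\<longrightarrow> inst t \<phi>"
| MP: "T \<turnstile> \<phi> \<^bold>\<longrightarrow> \<psi> \<Longrightarrow> T \<turnstile> \<phi> \<Longrightarrow> T \<turnstile> \<psi>"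
| Gen: "T \<turnstile> \<phi> \<Longrightarrow> T \<turnstile> All \<phi>"
| GenS: "T \<turnstile> \<phi> \<Longrightarrow> T \<turnstile> AllS \<phi>"

section \<open>The base system\<close>

text \<open>The bound \<open>t\<close> lives outside the quantifier, so the bound variable does not occur in it.\<close>

definition BAll :: "tm \<Rightarrow> fm \<Rightarrow> fm" where
  "BAll t \<phi> = All (Var 0 \<^bold>< lift 1 t \<^bold>\<longrightarrow> \<phi>)"

definition BEx :: "tm \<Rightarrow> fm \<Rightarrow> fm" where
  "BEx t \<phi> = Ex (Var 0 \<^bold>< lift 1 t \<^bold>\<and> \<phi>)"

inductive bounded :: "fm \<Rightarrow> bool" where
  "bounded (s \<^bold>= t)"
| "bounded (s \<^bold>< t)"
| "bounded (t \<^bold>\<in> X)"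
| "bounded \<phi> \<Longrightarrow> bounded (\<^bold>\<not> \<phi>)"
| "bounded \<phi> \<Longrightarrow> bounded \<psi> \<Longrightarrow> bounded (\<phi> \<^bold>\<longrightarrow> \<psi>)"
| "bounded \<phi> \<Longrightarrow> bounded (BAll t \<phi>)"
| "bounded \<phi> \<Longrightarrow> bounded (BEx t \<phi>)"

definition Sigma01 :: "fm set" where
  "Sigma01 = {Ex \<theta> |\<theta>. bounded \<theta>}"

definition Pi01 :: "fm set" where
  "Pi01 = {All \<theta> |\<theta>. bounded \<theta>}"

definition basic_axioms :: "fm set" where
  "basic_axioms =
    (let m = Var 0; n = Var 1 in
     {\<^bold>\<not> n \<^bold>+ \<^bold>1 \<^bold>= \<^bold>0,
      m \<^bold>+ \<^bold>1 \<^bold>= n \<^bold>+ \<^bold>1 \<^bold>\<longrightarrow> m \<^bold>= n,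
      m \<^bold>+ \<^bold>0 \<^bold>= m,
      m \<^bold>+ (n \<^bold>+ \<^bold>1) \<^bold>= (m \<^bold>+ n) \<^bold>+ \<^bold>1,
      m \<^bold>* \<^bold>0 \<^bold>= \<^bold>0,
      m \<^bold>* (n \<^bold>+ \<^bold>1) \<^bold>= (m \<^bold>* n) \<^bold>+ m,
      \<^bold>\<not> m \<^bold>< \<^bold>0,
      m \<^bold>< n \<^bold>+ \<^bold>1 \<^bold>\<longleftrightarrow> (m \<^bold>< n \<^bold>\<or> m \<^bold>= n)})"

text \<open>In both schemes number index 0 of \<open>\<phi>\<close> is the induction/comprehension variable \<open>n\<close>; all
  other free variables of \<open>\<phi>\<close>, of either sort, are parameters.\<close>

definition induction_axiom :: "fm \<Rightarrow> fm" where
  "induction_axiom \<phi> =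
    (inst \<^bold>0 \<phi> \<^bold>\<and>
     All (\<phi> \<^bold>\<longrightarrow> subst (case_nat (Var 0 \<^bold>+ \<^bold>1) (\<lambda>i. Var (Suc i))) (\<lambda>X. X) \<phi>) \<^bold>\<longrightarrow> All \<phi>)"

definition comprehension_axiom :: "fm \<Rightarrow> fm \<Rightarrow> fm" where
  "comprehension_axiom \<phi> \<psi> =
    (All (\<phi> \<^bold>\<longleftrightarrow> \<psi>) \<^bold>\<longrightarrow> ExS (All (Var 0 \<^bold>\<in> 0 \<^bold>\<longleftrightarrow> liftS_fm \<phi>)))"

definition RCA0 :: "fm set" where
  "RCA0 = basic_axioms
    \<union> {induction_axiom \<phi> |\<phi>. \<phi> \<in> Sigma01}
    \<union> {comprehension_axiom \<phi> \<psi> |\<phi> \<psi>. \<phi> \<in> Sigma01 \<and> \<psi> \<in> Pi01}"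

section \<open>Ramsey's theorem for triples and two colours\<close>

text \<open>The map \<open>(i, j) \<mapsto> (i + j)\<^sup>2 + i\<close> is injective, and \<open>i\<close> and \<open>j\<close> are at most its value.\<close>

definition pair :: "tm \<Rightarrow> tm \<Rightarrow> tm" where
  "pair s t = (s \<^bold>+ t) \<^bold>* (s \<^bold>+ t) \<^bold>+ s"

text \<open>A 3-element set is coded by its increasing enumeration \<open>a < b < c\<close>; this is the (code of
  the) element of \<open>[\<nat>]\<^sup>3 \<times> \<nat>\<close> consisting of \<open>{a, b, c}\<close> and \<open>i\<close>.\<close>

definition coloured :: "tm \<Rightarrow> tm \<Rightarrow> tm \<Rightarrow> tm \<Rightarrow> tm" where
  "coloured a b c i = pair (pair a (pair b c)) i"

text \<open>\<open>C\<close> is (the graph of) a function from \<open>[\<nat>]\<^sup>3\<close> to \<open>{0, 1}\<close>.\<close>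

definition colouring :: "nat \<Rightarrow> fm" where
  "colouring C =
    (All (Var 0 \<^bold>\<in> C \<^bold>\<longrightarrow>
       Ex (Ex (Ex (Ex (let i = Var 0; c = Var 1; b = Var 2; a = Var 3; p = Var 4 in
         a \<^bold>< b \<^bold>\<and> b \<^bold>< c \<^bold>\<and> (i \<^bold>= \<^bold>0 \<^bold>\<or> i \<^bold>= \<^bold>1) \<^bold>\<and> p \<^bold>= coloured a b c i))))) \<^bold>\<and>
     All (All (All (let c = Var 0; b = Var 1; a = Var 2 in
       a \<^bold>< b \<^bold>\<and> b \<^bold>< c \<^bold>\<longrightarrow>
         (coloured a b c \<^bold>0 \<^bold>\<in> C \<^bold>\<longleftrightarrow> \<^bold>\<not> coloured a b c \<^bold>1 \<^bold>\<in> C)))))"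

definition infinite_set :: "nat \<Rightarrow> fm" where
  "infinite_set H = All (Ex (Var 1 \<^bold>< Var 0 \<^bold>\<and> Var 0 \<^bold>\<in> H))"

definition homogeneous :: "nat \<Rightarrow> nat \<Rightarrow> fm" where
  "homogeneous H C =
    Ex (All (All (All (let c = Var 0; b = Var 1; a = Var 2; i = Var 3 in
      a \<^bold>\<in> H \<^bold>\<and> b \<^bold>\<in> H \<^bold>\<and> c \<^bold>\<in> H \<^bold>\<and> a \<^bold>< b \<^bold>\<and> b \<^bold>< c \<^bold>\<longrightarrow> coloured a b c i \<^bold>\<in> C))))"

definition RT32 :: fm where
  "RT32 = AllS (colouring 0 \<^bold>\<longrightarrow> ExS (infinite_set 0 \<^bold>\<and> homogeneous 0 1))"

section \<open>The Turing jump\<close>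

text \<open>
  Oracle register machines. A program is a finite list of instructions, each a quadruple
  \<open>(k, r, p, q)\<close> acting on register \<open>r\<close> with oracle \<open>X\<close>:

  \<^item> \<open>k = 0\<close>: increment register \<open>r\<close> and go to instruction \<open>p\<close>;
  \<^item> \<open>k = 1\<close>: if register \<open>r\<close> is 0 go to \<open>q\<close>, otherwise decrement it and go to \<open>p\<close>;
  \<^item> \<open>k = 2\<close>: if the content of register \<open>r\<close> belongs to \<open>X\<close> go to \<open>p\<close>, otherwise go to \<open>q\<close>.

  A machine starts at instruction 0 with its input in register 0 and all other registers empty,
  and it halts when it is sent to an instruction number not smaller than the length of its
  program. Finite sequences are coded with Goedel's beta function:
  \<open>beta u v i x\<close> says that \<open>x\<close> is the remainder of \<open>u\<close> modulo \<open>1 + (i + 1) v\<close>.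
\<close>

definition beta :: "tm \<Rightarrow> tm \<Rightarrow> tm \<Rightarrow> tm \<Rightarrow> fm" where
  "beta u v i x =
    (let m = (i \<^bold>+ \<^bold>1) \<^bold>* v \<^bold>+ \<^bold>1 in
     x \<^bold>< m \<^bold>\<and> BEx (u \<^bold>+ \<^bold>1) (lift 1 u \<^bold>= Var 0 \<^bold>* lift 1 m \<^bold>+ lift 1 x))"

text \<open>A number \<open>pair a (pair b n)\<close> codes the program of length \<open>n\<close> whose instruction number \<open>l\<close>
  is the \<open>l\<close>-th term of the sequence coded by \<open>a\<close>, \<open>b\<close>.\<close>

definition instruction :: "tm \<Rightarrow> tm \<Rightarrow> tm \<Rightarrow> tm \<Rightarrow> tm \<Rightarrow> tm \<Rightarrow> tm \<Rightarrow> fm" where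
  "instruction a b l k r p q = beta a b l (pair (pair k r) (pair p q))"

text \<open>A run is a sequence (coded by \<open>u\<close>, \<open>v\<close>) that holds the current instruction number of time
  \<open>t\<close> at position \<open>(t, 0)\<close> and the content of register \<open>r\<close> at time \<open>t\<close> at position
  \<open>(t, r + 1)\<close>.\<close>

definition label :: "tm \<Rightarrow> tm \<Rightarrow> tm \<Rightarrow> tm \<Rightarrow> fm" where
  "label u v t l = beta u v (pair t \<^bold>0) l"

definition reg :: "tm \<Rightarrow> tm \<Rightarrow> tm \<Rightarrow> tm \<Rightarrow> tm \<Rightarrow> fm" where
  "reg u v t r x = beta u v (pair t (r \<^bold>+ \<^bold>1)) x"

primrec BExs :: "nat \<Rightarrow> tm \<Rightarrow> fm \<Rightarrow> fm" where
  "BExs 0 t \<phi> = \<phi>"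
| "BExs (Suc m) t \<phi> = BEx t (BExs m (lift 1 t) \<phi>)"

text \<open>The transition from time \<open>t\<close> to time \<open>t + 1\<close>; \<open>z\<close> bounds the values that occur. All
  registers mentioned in a program are bounded by its code \<open>e\<close>, so it suffices to record
  these.\<close>

definition step :: "nat \<Rightarrow> tm \<Rightarrow> tm \<Rightarrow> tm \<Rightarrow> tm \<Rightarrow> tm \<Rightarrow> tm \<Rightarrow> tm \<Rightarrow> tm \<Rightarrow> fm" where
  "step X z e a b n u v t =
    BExs 8 z
     (let y = Var 0; x = Var 1; l' = Var 2; l = Var 3; q = Var 4; p = Var 5; r = Var 6; k = Var 7;
          z = lift 8 z; e = lift 8 e; a = lift 8 a; b = lift 8 b; n = lift 8 n;
          u = lift 8 u; v = lift 8 v; t = lift 8 t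
      in label u v t l \<^bold>\<and> l \<^bold>< n \<^bold>\<and> instruction a b l k r p q \<^bold>\<and>
         reg u v t r x \<^bold>\<and> reg u v (t \<^bold>+ \<^bold>1) r y \<^bold>\<and> label u v (t \<^bold>+ \<^bold>1) l' \<^bold>\<and>
         ((k \<^bold>= \<^bold>0 \<^bold>\<and> y \<^bold>= x \<^bold>+ \<^bold>1 \<^bold>\<and> l' \<^bold>= p) \<^bold>\<or>
          (k \<^bold>= \<^bold>1 \<^bold>\<and> x \<^bold>= \<^bold>0 \<^bold>\<and> y \<^bold>= \<^bold>0 \<^bold>\<and> l' \<^bold>= q) \<^bold>\<or>
          (k \<^bold>= \<^bold>1 \<^bold>\<and> x \<^bold>= y \<^bold>+ \<^bold>1 \<^bold>\<and> l' \<^bold>= p) \<^bold>\<or>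
          (k \<^bold>= \<^bold>1 \<^bold>+ \<^bold>1 \<^bold>\<and> x \<^bold>\<in> X \<^bold>\<and> y \<^bold>= x \<^bold>\<and> l' \<^bold>= p) \<^bold>\<or>
          (k \<^bold>= \<^bold>1 \<^bold>+ \<^bold>1 \<^bold>\<and> \<^bold>\<not> x \<^bold>\<in> X \<^bold>\<and> y \<^bold>= x \<^bold>\<and> l' \<^bold>= q)) \<^bold>\<and>
         BAll (e \<^bold>+ \<^bold>1) (\<^bold>\<not> Var 0 \<^bold>= lift 1 r \<^bold>\<longrightarrow>
           BEx (lift 1 z)
            (let w = Var 0; j = Var 1; u = lift 2 u; v = lift 2 v; t = lift 2 t
             in reg u v t j w \<^bold>\<and> reg u v (t \<^bold>+ \<^bold>1) j w)))"

text \<open>The machine with the program coded by \<open>e\<close> and oracle \<open>X\<close> halts on input \<open>e\<close>, after \<open>s\<close> steps.\<close>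

definition halts :: "nat \<Rightarrow> tm \<Rightarrow> fm" where
  "halts X e =
    Ex (BExs 6 (Var 0)
     (let s = Var 0; v = Var 1; u = Var 2; n = Var 3; b = Var 4; a = Var 5; z = Var 6;
          e = lift 7 e
      in e \<^bold>= pair a (pair b n) \<^bold>\<and>
         label u v \<^bold>0 \<^bold>0 \<^bold>\<and> reg u v \<^bold>0 \<^bold>0 e \<^bold>\<and>
         BAll (e \<^bold>+ \<^bold>1) (\<^bold>\<not> Var 0 \<^bold>= \<^bold>0 \<^bold>\<longrightarrow> reg (lift 1 u) (lift 1 v) \<^bold>0 (Var 0) \<^bold>0) \<^bold>\<and>
         BAll s (step X (lift 1 z) (lift 1 e) (lift 1 a) (lift 1 b) (lift 1 n)
                   (lift 1 u) (lift 1 v) (Var 0)) \<^bold>\<and>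
         BEx z (label (lift 1 u) (lift 1 v) (lift 1 s) (Var 0) \<^bold>\<and> \<^bold>\<not> Var 0 \<^bold>< lift 1 n)))"

text \<open>\<open>Y\<close> is the Turing jump of \<open>X\<close>.\<close>

definition is_jump :: "nat \<Rightarrow> nat \<Rightarrow> fm" where
  "is_jump Y X = All (Var 0 \<^bold>\<in> Y \<^bold>\<longleftrightarrow> halts X (Var 0))"

definition ACA :: fm where
  "ACA = AllS (ExS (is_jump 0 1))"

end

theory Submission
  imports Defs "HOL-Library.Countable_Set"
begin

text \<open>
  Formal derivations in the calculus are avoided: by the completeness theorem it is enough to
  look at an arbitrary countable model of the base system, which may be nonstandard, and to
  show that its sets contain all jumps if Ramsey's theorem holds in it.

  Completeness is Henkin's. A consistent finite set of formulas extends to a maximal consistent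
  set with witnesses, and the terms modulo provable equality form a model. Witnesses are fresh
  free variables, which works because provability is closed under substitution
  (\<open>provable_subst\<close>). The universe can be taken to be the type of natural numbers, since the
  basic axioms make all numerals distinct (\<open>countable_model\<close>).

  All that is used of machines is that halting is expressed by one unbounded existential
  quantifier before a bounded formula. So it remains to prove that every predicate
  of the form \<open>\<exists>s. \<theta> s n\<close> with bounded \<open>\<theta>\<close> defines a set
  (\<open>Sigma1_comprehension\<close>). Call \<open>n\<close> enumerated by stage \<open>t\<close> if \<open>n < t\<close> and \<open>\<theta> s n\<close> for some
  \<open>s < t\<close>, and let \<open>d x y\<close> be the least number enumerated by stage \<open>y\<close> but not by stage \<open>x\<close>
  (infinite if there is none). Colour \<open>x < y < z\<close> according to whether \<open>d y z < d x y\<close>, and let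
  \<open>G\<close> be an infinite homogeneous set.

  If \<open>d y z < d x y\<close> always holds on \<open>G\<close>, then the values of \<open>d\<close> on \<open>G\<close> have no least element,
  which contradicts Sigma-1 induction. Otherwise \<open>d x y \<le> d y z\<close> throughout \<open>G\<close>. As a number is
  enumerated for the first time only once, finite values of \<open>d\<close> increase strictly along \<open>G\<close>,
  so by Sigma-1 induction \<open>d\<close> exceeds every given \<open>n\<close> at some pair \<open>x < y\<close> of \<open>G\<close>. All
  numbers first enumerated after stage \<open>y\<close> are then larger than \<open>n\<close>, so \<open>n\<close> is ever
  enumerated if and only if it is enumerated by stage \<open>y\<close>. This makes the complement
  of the predicate Sigma-1 in \<open>G\<close> as well, and Delta-1 comprehension gives the set.

  The colouring compares least new numbers, and not approximations to the predicate on initial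
  segments, in order that both cases are decided by induction on formulas with a single
  unbounded quantifier.
\<close>

section \<open>Substitution\<close>

(* The definitions speak of lifting by the numeral 1, which should stay a numeral. *)
declare One_nat_def [simp del]

text \<open>The substitutions that \<^const>\<open>subst\<close> uses below a number quantifier and below a set
  quantifier.\<close>

abbreviation up :: "(nat \<Rightarrow> tm) \<Rightarrow> nat \<Rightarrow> tm" where
  "up \<sigma> \<equiv> case_nat (Var 0) (\<lambda>i. lift 1 (\<sigma> i))"

abbreviation upS :: "(nat \<Rightarrow> nat) \<Rightarrow> nat \<Rightarrow> nat" where
  "upS \<rho> \<equiv> case_nat 0 (\<lambda>i. Suc (\<rho> i))"

lemma substt_substt: "substt \<sigma> (substt \<tau> t) = substt (\<lambda>i. substt \<sigma> (\<tau> i)) t"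
  by (induction t) auto

lemma substt_Var [simp]: "substt Var t = t"
  by (induction t) auto

lemma lift_1: "lift 1 = substt (\<lambda>i. Var (Suc i))"
  unfolding lift_def Suc_eq_plus1 ..

lemma lift_1_Var [simp]: "lift 1 (Var i) = Var (Suc i)"
  by (simp add: lift_1)

lemma up_Var [simp]: "case_nat (Var 0) (\<lambda>i. Var (Suc i)) = Var"
  by (auto split: nat.split)

lemma upS_id [simp]: "case_nat 0 Suc = (\<lambda>X. X)"
  by (auto split: nat.split)

lemma subst_Var [simp]: "subst Var (\<lambda>X. X) \<phi> = \<phi>"
  by (induction \<phi>) auto

lemma substt_up_lift: "substt (up \<sigma>) (lift 1 t) = lift 1 (substt \<sigma> t)"
  by (simp add: lift_1 substt_substt)

lemma subst_subst:
  "subst \<sigma> \<rho> (subst \<tau> \<pi> \<phi>) = subst (\<lambda>i. substt \<sigma> (\<tau> i)) (\<lambda>X. \<rho> (\<pi> X)) \<phi>"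
proof (induction \<phi> arbitrary: \<sigma> \<rho> \<tau> \<pi>)
  case (All \<phi>)
  have "(\<lambda>i. substt (up \<sigma>) (up \<tau> i)) = up (\<lambda>i. substt \<sigma> (\<tau> i))"
    by (auto simp: substt_up_lift split: nat.split)
  with All show ?case by simp
next
  case (AllS \<phi>)
  have "(\<lambda>X. upS \<rho> (upS \<pi> X)) = upS (\<lambda>X. \<rho> (\<pi> X))"
    by (auto split: nat.split)
  with AllS show ?case by simp
qed (auto simp: substt_substt)

lemma inst_subst_up: "inst t (subst (up \<sigma>) \<rho> \<phi>) = subst (case_nat t \<sigma>) \<rho> \<phi>"
proof -
  have "(\<lambda>i. substt (case_nat t Var) (up \<sigma> i)) = case_nat t \<sigma>"
    by (auto simp: lift_1 substt_substt split: nat.split)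
  then show ?thesis
    by (simp add: inst_def subst_subst)
qed

lemma instS_subst_upS: "instS Y (subst \<sigma> (upS \<rho>) \<phi>) = subst \<sigma> (case_nat Y \<rho>) \<phi>"
proof -
  have "(\<lambda>X. case_nat Y (\<lambda>X. X) (upS \<rho> X)) = case_nat Y \<rho>"
    by (auto split: nat.split)
  then show ?thesis
    by (simp add: instS_def subst_subst)
qed

text \<open>The bound \<open>n\<close> exceeds all free variables, those of both sorts in the case of formulas. It is
  characterised by the effect of substitutions because this is how freshness is used.\<close>

definition tvars_below :: "nat \<Rightarrow> tm \<Rightarrow> bool" where
  "tvars_below n t \<longleftrightarrow> (\<forall>\<sigma> \<tau>. (\<forall>i<n. \<sigma> i = \<tau> i) \<longrightarrow> substt \<sigma> t = substt \<tau> t)"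

lemma tvars_belowD:
  assumes "tvars_below n t" "\<And>i. i < n \<Longrightarrow> \<sigma> i = \<tau> i"
  shows "substt \<sigma> t = substt \<tau> t"
  using assms by (simp add: tvars_below_def)

lemma tvars_belowI:
  assumes "\<And>\<sigma> \<tau>. (\<And>i. i < n \<Longrightarrow> \<sigma> i = \<tau> i) \<Longrightarrow> substt \<sigma> t = substt \<tau> t"
  shows "tvars_below n t"
  unfolding tvars_below_def by (intro allI impI assms) simp

lemma tvars_below_ex: "\<exists>n. tvars_below n t"
proof (induction t)
  case (Var i)
  show ?case by (rule exI[of _ "Suc i"], rule tvars_belowI) simp
next
  case (Add s t)
  then obtain m n where "tvars_below m s" "tvars_below n t" by blast
  then have "tvars_below (max m n) (s \<^bold>+ t)"
    by (intro tvars_belowI, unfold substt.simps subst.simps)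
      (rule arg_cong2[where f = Add]; (erule tvars_belowD)?; simp)
  then show ?case ..
next
  case (Mul s t)
  then obtain m n where "tvars_below m s" "tvars_below n t" by blast
  then have "tvars_below (max m n) (s \<^bold>* t)"
    by (intro tvars_belowI, unfold substt.simps subst.simps)
      (rule arg_cong2[where f = Mul]; (erule tvars_belowD)?; simp)
  then show ?case ..
qed (simp_all add: tvars_below_def)

definition vars_below :: "nat \<Rightarrow> fm \<Rightarrow> bool" where
  "vars_below n \<phi> \<longleftrightarrow>
    (\<forall>\<sigma> \<tau> \<rho> \<pi>. (\<forall>i<n. \<sigma> i = \<tau> i \<and> \<rho> i = \<pi> i) \<longrightarrow> subst \<sigma> \<rho> \<phi> = subst \<tau> \<pi> \<phi>)"

lemma vars_belowD:
  assumes "vars_below n \<phi>" "\<And>i. i < n \<Longrightarrow> \<sigma> i = \<tau> i" "\<And>i. i < n \<Longrightarrow> \<rho> i = \<pi> i"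
  shows "subst \<sigma> \<rho> \<phi> = subst \<tau> \<pi> \<phi>"
  using assms by (simp add: vars_below_def)

lemma vars_belowI:
  assumes "\<And>\<sigma> \<tau> \<rho> \<pi>. (\<And>i. i < n \<Longrightarrow> \<sigma> i = \<tau> i) \<Longrightarrow> (\<And>i. i < n \<Longrightarrow> \<rho> i = \<pi> i) \<Longrightarrow>
    subst \<sigma> \<rho> \<phi> = subst \<tau> \<pi> \<phi>"
  shows "vars_below n \<phi>"
  unfolding vars_below_def by (intro allI impI assms) auto

lemma vars_below_mono: "vars_below m \<phi> \<Longrightarrow> m \<le> n \<Longrightarrow> vars_below n \<phi>"
  by (intro vars_belowI, erule vars_belowD) simp_all

lemma vars_below_ex: "\<exists>n. vars_below n \<phi>"
proof (induction \<phi>)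
  case (Eq s t)
  obtain m n where "tvars_below m s" "tvars_below n t" using tvars_below_ex by blast
  then have "vars_below (max m n) (s \<^bold>= t)"
    by (intro vars_belowI, unfold substt.simps subst.simps)
      (rule arg_cong2[where f = Eq]; (erule tvars_belowD)?; simp)
  then show ?case ..
next
  case (Lt s t)
  obtain m n where "tvars_below m s" "tvars_below n t" using tvars_below_ex by blast
  then have "vars_below (max m n) (s \<^bold>< t)"
    by (intro vars_belowI, unfold substt.simps subst.simps)
      (rule arg_cong2[where f = Lt]; (erule tvars_belowD)?; simp)
  then show ?case ..
next
  case (In t X)
  obtain n where "tvars_below n t" using tvars_below_ex by blast
  then have "vars_below (max n (Suc X)) (t \<^bold>\<in> X)"
    by (intro vars_belowI, unfold substt.simps subst.simps)
      (rule arg_cong2[where f = In]; (erule tvars_belowD)?; simp)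
  then show ?case ..
next
  case (Neg \<phi>)
  then obtain n where "vars_below n \<phi>" ..
  then have "vars_below n (\<^bold>\<not> \<phi>)"
    by (intro vars_belowI, unfold substt.simps subst.simps)
      (rule arg_cong[where f = Neg]; (erule vars_belowD)?; simp)
  then show ?case ..
next
  case (Imp \<phi> \<psi>)
  then obtain m n where "vars_below m \<phi>" "vars_below n \<psi>" by blast
  then have "vars_below (max m n) (\<phi> \<^bold>\<longrightarrow> \<psi>)"
    by (intro vars_belowI, unfold substt.simps subst.simps)
      (rule arg_cong2[where f = Imp]; (erule vars_belowD)?; simp)
  then show ?case ..
next
  case (All \<phi>)
  then obtain n where n: "vars_below n \<phi>" ..
  have "vars_below n (All \<phi>)"
    by (intro vars_belowI, simp only: subst.simps fm.inject, rule vars_belowD[OF n])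
      (auto split: nat.split)
  then show ?case ..
next
  case (AllS \<phi>)
  then obtain n where n: "vars_below n \<phi>" ..
  have "vars_below n (AllS \<phi>)"
    by (intro vars_belowI, simp only: subst.simps fm.inject, rule vars_belowD[OF n])
      (auto split: nat.split)
  then show ?case ..
qed

lemma vars_below_finite:
  assumes "finite \<Gamma>" shows "\<exists>n. \<forall>\<phi>\<in>\<Gamma>. vars_below n \<phi>"
  using assms
proof induction
  case (insert \<phi> \<Gamma>)
  then obtain m n where "\<forall>\<psi>\<in>\<Gamma>. vars_below m \<psi>" "vars_below n \<phi>"
    using vars_below_ex by blast
  then have "\<forall>\<psi>\<in>insert \<phi> \<Gamma>. vars_below (max m n) \<psi>"
    using vars_below_mono[of m _ "max m n"] vars_below_mono[of n _ "max m n"] by auto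
  then show ?case ..
qed simp

section \<open>Derivations from hypotheses\<close>

text \<open>Single instances add up to a simultaneous substitution: generalise the variables first and
  instantiate them from the outermost quantifier inwards. A term that has been put in is then
  never touched by a later instantiation.\<close>

lemma provable_subst_prefix:
  assumes "T \<turnstile> \<phi>"
  shows "T \<turnstile> subst (\<lambda>i. if i < n then \<sigma> i else Var (i - n)) (\<lambda>X. X) \<phi>"
  using assms
proof (induction n arbitrary: \<phi> \<sigma>)
  case (Suc n)
  let ?\<tau> = "\<lambda>i. if i < n then \<sigma> (Suc i) else Var (i - n)"
  have "T \<turnstile> subst ?\<tau> (\<lambda>X. X) (All \<phi>)"
    using Suc.IH[OF Gen[OF Suc.prems]] .
  then have "T \<turnstile> inst (\<sigma> 0) (subst (up ?\<tau>) (\<lambda>X. X) \<phi>)"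
    by (simp only: subst.simps) (rule MP[OF All_inst])
  moreover have "case_nat (\<sigma> 0) ?\<tau> = (\<lambda>i. if i < Suc n then \<sigma> i else Var (i - Suc n))"
    by (rule ext) (simp split: nat.split)
  ultimately show ?case
    by (simp only: inst_subst_up)
qed simp

lemma provable_substS_prefix:
  assumes "T \<turnstile> \<phi>"
  shows "T \<turnstile> subst Var (\<lambda>X. if X < n then \<rho> X else X - n) \<phi>"
  using assms
proof (induction n arbitrary: \<phi> \<rho>)
  case (Suc n)
  let ?\<pi> = "\<lambda>X. if X < n then \<rho> (Suc X) else X - n"
  have "T \<turnstile> subst Var ?\<pi> (AllS \<phi>)"
    using Suc.IH[OF GenS[OF Suc.prems]] .
  then have "T \<turnstile> instS (\<rho> 0) (subst Var (upS ?\<pi>) \<phi>)"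
    by (simp only: subst.simps) (rule MP[OF AllS_inst])
  moreover have "case_nat (\<rho> 0) ?\<pi> = (\<lambda>X. if X < Suc n then \<rho> X else X - Suc n)"
    by (rule ext) (simp split: nat.split)
  ultimately show ?case
    by (simp only: instS_subst_upS)
qed simp

text \<open>This holds for every \<open>T\<close>, because the generalisation rules give each axiom the force of its
  universal closure; and only the finitely many variables of \<open>\<phi>\<close> must be instantiated.\<close>

lemma provable_subst: assumes "T \<turnstile> \<phi>" shows "T \<turnstile> subst \<sigma> \<rho> \<phi>"
proof -
  obtain n where n: "vars_below n \<phi>"
    using vars_below_ex by blast
  let ?\<sigma> = "\<lambda>i. if i < n then \<sigma> i else Var (i - n)"
  let ?\<rho> = "\<lambda>X. if X < n then \<rho> X else X - n"
  have "T \<turnstile> subst ?\<sigma> (\<lambda>X. X) (subst Var ?\<rho> \<phi>)"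
    by (intro provable_subst_prefix provable_substS_prefix assms)
  then have "T \<turnstile> subst ?\<sigma> ?\<rho> \<phi>"
    by (simp add: subst_subst)
  also have "subst ?\<sigma> ?\<rho> \<phi> = subst \<sigma> \<rho> \<phi>"
    by (rule vars_belowD[OF n]) auto
  finally show ?thesis .
qed

text \<open>Consequences of a set \<open>\<Gamma>\<close> of local hypotheses, whose free variables may not be generalised.
  This is what makes the deduction theorem hold.\<close>

inductive der :: "fm set \<Rightarrow> fm set \<Rightarrow> fm \<Rightarrow> bool" for T \<Gamma> where
  hyp: "\<phi> \<in> \<Gamma> \<Longrightarrow> der T \<Gamma> \<phi>"
| ax: "T \<turnstile> \<phi> \<Longrightarrow> der T \<Gamma> \<phi>"
| mp: "der T \<Gamma> (\<phi> \<^bold>\<longrightarrow> \<psi>) \<Longrightarrow> der T \<Gamma> \<phi> \<Longrightarrow> der T \<Gamma> \<psi>"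

lemma der_empty: "der T {} \<phi> \<Longrightarrow> T \<turnstile> \<phi>"
  by (induction rule: der.induct) (simp, assumption, rule MP)

lemma der_mono: assumes "der T \<Gamma> \<phi>" "\<Gamma> \<subseteq> \<Delta>" shows "der T \<Delta> \<phi>"
  using assms(1)
proof induction
  case (hyp \<phi>)
  then show ?case using assms(2) by (blast intro: der.hyp)
qed (rule ax mp, assumption+)+

lemma der_insert: "der T \<Gamma> \<phi> \<Longrightarrow> der T (insert \<psi> \<Gamma>) \<phi>"
  by (erule der_mono) blast

lemma der_finite: "der T \<Gamma> \<phi> \<Longrightarrow> \<exists>\<Delta>\<subseteq>\<Gamma>. finite \<Delta> \<and> der T \<Delta> \<phi>"
proof (induction rule: der.induct)
  case (hyp \<phi>)
  then show ?case by (intro exI[of _ "{\<phi>}"]) (auto intro: der.hyp)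
next
  case (ax \<phi>)
  then show ?case by (intro exI[of _ "{}"]) (auto intro: der.ax)
next
  case (mp \<phi> \<psi>)
  then obtain \<Delta> \<Delta>' where "\<Delta> \<subseteq> \<Gamma>" "finite \<Delta>" "der T \<Delta> (\<phi> \<^bold>\<longrightarrow> \<psi>)"
    "\<Delta>' \<subseteq> \<Gamma>" "finite \<Delta>'" "der T \<Delta>' \<phi>" by blast
  then have "der T (\<Delta> \<union> \<Delta>') (\<phi> \<^bold>\<longrightarrow> \<psi>)" "der T (\<Delta> \<union> \<Delta>') \<phi>"
    using der_mono[of T _ _ "\<Delta> \<union> \<Delta>'"] by auto
  then have "der T (\<Delta> \<union> \<Delta>') \<psi>"
    by (rule der.mp)
  with mp show ?case
    by (intro exI[of _ "\<Delta> \<union> \<Delta>'"]) (use \<open>\<Delta> \<subseteq> \<Gamma>\<close> \<open>finite \<Delta>\<close> \<open>\<Delta>' \<subseteq> \<Gamma>\<close> \<open>finite \<Delta>'\<close> in blast)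
qed

lemma der_K: "der T \<Gamma> \<phi> \<Longrightarrow> der T \<Gamma> (\<psi> \<^bold>\<longrightarrow> \<phi>)"
  by (rule mp[OF ax[OF K]])

lemma der_imp_refl: "der T \<Gamma> (\<phi> \<^bold>\<longrightarrow> \<phi>)"
  using mp[OF mp[OF ax[OF S] ax[OF K]] ax[OF K[of T \<phi> \<phi>]]] .

lemma deduction: "der T (insert \<psi> \<Gamma>) \<phi> \<Longrightarrow> der T \<Gamma> (\<psi> \<^bold>\<longrightarrow> \<phi>)"
proof (induction rule: der.induct)
  case (hyp \<phi>)
  then show ?case by (auto intro: der_imp_refl der_K der.hyp)
next
  case (ax \<phi>)
  then show ?case by (auto intro: der_K der.ax)
next
  case (mp \<phi> \<chi>)
  show ?case
    by (rule der.mp[OF der.mp[OF der.ax[OF S] mp.IH(1)] mp.IH(2)])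
qed

lemma der_contra:
  assumes "der T (insert (\<^bold>\<not> \<phi>) \<Gamma>) \<psi>" "der T (insert (\<^bold>\<not> \<phi>) \<Gamma>) (\<^bold>\<not> \<psi>)"
  shows "der T \<Gamma> \<phi>"
  by (rule mp[OF mp[OF ax[OF Contra] deduction] deduction]) (rule assms)+

lemma der_explode: "der T \<Gamma> \<phi> \<Longrightarrow> der T \<Gamma> (\<^bold>\<not> \<phi>) \<Longrightarrow> der T \<Gamma> \<psi>"
  by (rule der_contra) (erule der_insert)+

lemma der_notI:
  assumes "der T (insert \<phi> \<Gamma>) \<psi>" "der T (insert \<phi> \<Gamma>) (\<^bold>\<not> \<psi>)"
  shows "der T \<Gamma> (\<^bold>\<not> \<phi>)"
proof (rule der_contra)
  let ?\<Delta> = "insert (\<^bold>\<not> \<^bold>\<not> \<phi>) \<Gamma>"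
  have \<phi>: "der T ?\<Delta> \<phi>"
    by (rule der_contra[of _ _ _ "\<^bold>\<not> \<phi>"]) (auto intro: hyp)
  show "der T ?\<Delta> \<psi>" "der T ?\<Delta> (\<^bold>\<not> \<psi>)"
    using assms[THEN deduction, THEN der_insert, THEN mp, OF \<phi>] by blast+
qed

lemma der_subst: "der T \<Gamma> \<phi> \<Longrightarrow> der T (subst \<sigma> \<rho> ` \<Gamma>) (subst \<sigma> \<rho> \<phi>)"
  by (induction rule: der.induct) (auto intro: hyp ax provable_subst, metis mp subst.simps(5))

lemma der_Gen: "finite \<Gamma> \<Longrightarrow> der T (lift_fm ` \<Gamma>) \<phi> \<Longrightarrow> der T \<Gamma> (All \<phi>)"
proof (induction \<Gamma> arbitrary: \<phi> rule: finite_induct)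
  case empty
  then show ?case by (auto intro!: ax Gen dest: der_empty)
next
  case (insert \<psi> \<Gamma>)
  from insert.prems have "der T (lift_fm ` \<Gamma>) (lift_fm \<psi> \<^bold>\<longrightarrow> \<phi>)"
    by (simp add: deduction)
  then have "der T \<Gamma> (\<psi> \<^bold>\<longrightarrow> All \<phi>)"
    by (rule mp[OF ax[OF All_dist] insert.IH])
  then show ?case
    by (rule mp[OF der_insert hyp]) simp
qed

lemma der_GenS: "finite \<Gamma> \<Longrightarrow> der T (liftS_fm ` \<Gamma>) \<phi> \<Longrightarrow> der T \<Gamma> (AllS \<phi>)"
proof (induction \<Gamma> arbitrary: \<phi> rule: finite_induct)
  case empty
  then show ?case by (auto intro!: ax GenS dest: der_empty)
next
  case (insert \<psi> \<Gamma>)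
  from insert.prems have "der T (liftS_fm ` \<Gamma>) (liftS_fm \<psi> \<^bold>\<longrightarrow> \<phi>)"
    by (simp add: deduction)
  then have "der T \<Gamma> (\<psi> \<^bold>\<longrightarrow> AllS \<phi>)"
    by (rule mp[OF ax[OF AllS_dist] insert.IH])
  then show ?case
    by (rule mp[OF der_insert hyp]) simp
qed

text \<open>Renaming the fresh variable \<open>n\<close> to the innermost index and shifting all others turns the
  hypotheses into their lifted versions, and the instance back into \<open>\<phi>\<close>.\<close>

lemma der_All_fresh:
  assumes "finite \<Gamma>" "\<And>\<psi>. \<psi> \<in> insert \<phi> \<Gamma> \<Longrightarrow> vars_below n \<psi>" "der T \<Gamma> (inst (Var n) \<phi>)"
  shows "der T \<Gamma> (All \<phi>)"
proof -
  let ?\<sigma> = "\<lambda>i. if i = n then Var 0 else Var (Suc i)"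
  have "(\<lambda>i. substt ?\<sigma> (case_nat (Var n) Var i)) = case_nat (Var 0) ?\<sigma>"
    by (auto split: nat.split)
  then have "subst ?\<sigma> (\<lambda>X. X) (inst (Var n) \<phi>) = subst (case_nat (Var 0) ?\<sigma>) (\<lambda>X. X) \<phi>"
    by (simp add: inst_def subst_subst)
  also have "\<dots> = subst Var (\<lambda>X. X) \<phi>"
    by (rule vars_belowD[OF assms(2)]) (auto split: nat.split)
  finally have "subst ?\<sigma> (\<lambda>X. X) (inst (Var n) \<phi>) = \<phi>" by simp
  moreover have "subst ?\<sigma> (\<lambda>X. X) ` \<Gamma> = lift_fm ` \<Gamma>"
    unfolding lift_fm_def by (intro image_cong refl vars_belowD[OF assms(2)]) auto
  ultimately show ?thesis
    using der_subst[OF assms(3), of ?\<sigma> "\<lambda>X. X"] assms(1) by (auto intro: der_Gen)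
qed

lemma der_AllS_fresh:
  assumes "finite \<Gamma>" "\<And>\<psi>. \<psi> \<in> insert \<phi> \<Gamma> \<Longrightarrow> vars_below n \<psi>" "der T \<Gamma> (instS n \<phi>)"
  shows "der T \<Gamma> (AllS \<phi>)"
proof -
  let ?\<rho> = "\<lambda>X. if X = n then 0 else Suc X"
  have "(\<lambda>X. ?\<rho> (case_nat n (\<lambda>X. X) X)) = case_nat 0 ?\<rho>"
    by (auto split: nat.split)
  then have "subst Var ?\<rho> (instS n \<phi>) = subst Var (case_nat 0 ?\<rho>) \<phi>"
    by (simp add: instS_def subst_subst)
  also have "\<dots> = subst Var (\<lambda>X. X) \<phi>"
    by (rule vars_belowD[OF assms(2)]) (auto split: nat.split)
  finally have "subst Var ?\<rho> (instS n \<phi>) = \<phi>" by simp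
  moreover have "subst Var ?\<rho> ` \<Gamma> = liftS_fm ` \<Gamma>"
    unfolding liftS_fm_def by (intro image_cong refl vars_belowD[OF assms(2)]) auto
  ultimately show ?thesis
    using der_subst[OF assms(3), of Var ?\<rho>] assms(1) by (auto intro: der_GenS)
qed

section \<open>Structures and satisfaction\<close>

text \<open>Sets are subsets of the universe, and set quantifiers range over a given family of them
  (Henkin semantics).\<close>

record 'a L2_structure =
  zer :: 'a ("\<zero>\<index>")
  uno :: 'a ("\<one>\<index>")
  plu :: "'a \<Rightarrow> 'a \<Rightarrow> 'a" (infixl "\<oplus>\<index>" 65)
  tim :: "'a \<Rightarrow> 'a \<Rightarrow> 'a" (infixl "\<otimes>\<index>" 70)
  les :: "'a \<Rightarrow> 'a \<Rightarrow> bool" (infix "\<prec>\<index>" 50)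
  sets :: "'a set set"

primrec evalt :: "'a L2_structure \<Rightarrow> (nat \<Rightarrow> 'a) \<Rightarrow> tm \<Rightarrow> 'a" where
  "evalt M e (Var i) = e i"
| "evalt M e \<^bold>0 = \<zero>\<^bsub>M\<^esub>"
| "evalt M e \<^bold>1 = \<one>\<^bsub>M\<^esub>"
| "evalt M e (s \<^bold>+ t) = evalt M e s \<oplus>\<^bsub>M\<^esub> evalt M e t"
| "evalt M e (s \<^bold>* t) = evalt M e s \<otimes>\<^bsub>M\<^esub> evalt M e t"

primrec sat :: "'a L2_structure \<Rightarrow> (nat \<Rightarrow> 'a) \<Rightarrow> (nat \<Rightarrow> 'a set) \<Rightarrow> fm \<Rightarrow> bool" where
  "sat M e r (s \<^bold>= t) \<longleftrightarrow> evalt M e s = evalt M e t"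
| "sat M e r (s \<^bold>< t) \<longleftrightarrow> evalt M e s \<prec>\<^bsub>M\<^esub> evalt M e t"
| "sat M e r (t \<^bold>\<in> X) \<longleftrightarrow> evalt M e t \<in> r X"
| "sat M e r (\<^bold>\<not> \<phi>) \<longleftrightarrow> \<not> sat M e r \<phi>"
| "sat M e r (\<phi> \<^bold>\<longrightarrow> \<psi>) \<longleftrightarrow> (sat M e r \<phi> \<longrightarrow> sat M e r \<psi>)"
| "sat M e r (All \<phi>) \<longleftrightarrow> (\<forall>x. sat M (case_nat x e) r \<phi>)"
| "sat M e r (AllS \<phi>) \<longleftrightarrow> (\<forall>A\<in>sets M. sat M e (case_nat A r) \<phi>)"

section \<open>The completeness theorem\<close>

definition consistent :: "fm set \<Rightarrow> fm set \<Rightarrow> bool" where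
  "consistent T \<Gamma> \<longleftrightarrow> (\<exists>\<phi>. \<not> der T \<Gamma> \<phi>)"

text \<open>The named counterexamples are what makes the truth lemma hold for universal formulas.\<close>

definition settles :: "fm set \<Rightarrow> fm \<Rightarrow> bool" where
  "settles \<Gamma> \<phi> \<longleftrightarrow> \<phi> \<in> \<Gamma> \<or>
    (\<^bold>\<not> \<phi>) \<in> \<Gamma> \<and>
    (\<forall>\<psi>. \<phi> = All \<psi> \<longrightarrow> (\<exists>t. (\<^bold>\<not> inst t \<psi>) \<in> \<Gamma>)) \<and>
    (\<forall>\<psi>. \<phi> = AllS \<psi> \<longrightarrow> (\<exists>Y. (\<^bold>\<not> instS Y \<psi>) \<in> \<Gamma>))"

lemma settles_mono: "settles \<Gamma> \<phi> \<Longrightarrow> \<Gamma> \<subseteq> \<Delta> \<Longrightarrow> settles \<Delta> \<phi>"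
  unfolding settles_def by blast

lemma consistent_insert:
  assumes "consistent T \<Gamma>" "\<not> der T \<Gamma> \<phi>"
  shows "consistent T (insert (\<^bold>\<not> \<phi>) \<Gamma>)"
  using assms der_contra unfolding consistent_def by blast

text \<open>Only finitely many variables occur in \<open>\<Gamma>\<close>, so a fresh one can serve as counterexample to a
  refuted universal formula.\<close>

lemma settling_extension:
  assumes "finite \<Gamma>" "consistent T \<Gamma>"
  shows "\<exists>\<Delta>. \<Gamma> \<subseteq> \<Delta> \<and> finite \<Delta> \<and> consistent T \<Delta> \<and> settles \<Delta> \<phi>"
proof (cases "der T \<Gamma> \<phi>")
  case True
  have "consistent T (insert \<phi> \<Gamma>)"
  proof (rule ccontr)
    assume "\<not> consistent T (insert \<phi> \<Gamma>)"
    then have "der T \<Gamma> (\<^bold>\<not> \<phi>)"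
      unfolding consistent_def by (blast intro: der_notI)
    with True assms(2) show False
      unfolding consistent_def by (blast intro: der_explode)
  qed
  with assms(1) show ?thesis
    by (intro exI[of _ "insert \<phi> \<Gamma>"]) (auto simp: settles_def)
next
  case False
  let ?\<Gamma> = "insert (\<^bold>\<not> \<phi>) \<Gamma>"
  have con: "consistent T ?\<Gamma>"
    using assms(2) False by (rule consistent_insert)
  have nder: "\<not> der T ?\<Gamma> \<phi>"
    using con der_explode[OF _ hyp, of T ?\<Gamma> \<phi>] unfolding consistent_def by blast
  obtain n where n: "\<forall>\<psi>\<in>insert \<phi> ?\<Gamma>. vars_below n \<psi>"
    using vars_below_finite[of "insert \<phi> ?\<Gamma>"] assms(1) by blast
  show ?thesis
  proof (cases \<phi>)
    case (All \<psi>)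
    obtain m where m: "\<forall>\<psi>\<in>insert \<psi> ?\<Gamma>. vars_below m \<psi>"
      using vars_below_finite[of "insert \<psi> ?\<Gamma>"] assms(1) by blast
    have "\<not> der T ?\<Gamma> (inst (Var m) \<psi>)"
      using nder der_All_fresh[of ?\<Gamma> \<psi> m T] m assms(1) All by auto
    with con have "consistent T (insert (\<^bold>\<not> inst (Var m) \<psi>) ?\<Gamma>)"
      by (rule consistent_insert)
    with assms(1) All show ?thesis
      by (intro exI[of _ "insert (\<^bold>\<not> inst (Var m) \<psi>) ?\<Gamma>"]) (auto simp: settles_def)
  next
    case (AllS \<psi>)
    obtain m where m: "\<forall>\<psi>\<in>insert \<psi> ?\<Gamma>. vars_below m \<psi>"
      using vars_below_finite[of "insert \<psi> ?\<Gamma>"] assms(1) by blast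
    have "\<not> der T ?\<Gamma> (instS m \<psi>)"
      using nder der_AllS_fresh[of ?\<Gamma> \<psi> m T] m assms(1) AllS by auto
    with con have "consistent T (insert (\<^bold>\<not> instS m \<psi>) ?\<Gamma>)"
      by (rule consistent_insert)
    with assms(1) AllS show ?thesis
      by (intro exI[of _ "insert (\<^bold>\<not> instS m \<psi>) ?\<Gamma>"]) (auto simp: settles_def)
  qed (use con assms(1) in \<open>auto simp: settles_def intro!: exI[of _ ?\<Gamma>]\<close>)
qed

text \<open>Countability lets a single chain of length \<open>\<omega>\<close> settle all formulas.\<close>

instance tm :: countable by countable_datatype
instance fm :: countable by countable_datatype

locale henkin =
  fixes T \<Delta> :: "fm set"
  assumes consistent: "consistent T \<Delta>"
    and settled: "settles \<Delta> \<phi>"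

lemma henkin_extension:
  assumes "finite \<Gamma>" "consistent T \<Gamma>"
  obtains \<Delta> where "\<Gamma> \<subseteq> \<Delta>" "henkin T \<Delta>"
proof -
  let ?P = "\<lambda>\<Delta>. \<Gamma> \<subseteq> \<Delta> \<and> finite \<Delta> \<and> consistent T \<Delta>"
  have "\<exists>f. \<forall>n. ?P (f n) \<and> f n \<subseteq> f (Suc n) \<and> settles (f (Suc n)) (from_nat n)"
  proof (rule dependent_nat_choice)
    show "\<exists>\<Delta>. ?P \<Delta>" using assms by blast
  next
    fix \<Delta> n assume "?P \<Delta>"
    then show "\<exists>\<Delta>'. ?P \<Delta>' \<and> \<Delta> \<subseteq> \<Delta>' \<and> settles \<Delta>' (from_nat n)"
      using settling_extension[of \<Delta> T "from_nat n"] by blast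
  qed
  then obtain f where P: "\<And>n. ?P (f n)" and Suc: "\<And>n. f n \<subseteq> f (Suc n)"
    and set: "\<And>n. settles (f (Suc n)) (from_nat n)" by blast
  let ?\<Delta> = "\<Union>n. f n"
  have mono: "f m \<subseteq> f n" if "m \<le> n" for m n
    using Suc that by (rule lift_Suc_mono_le)
  \<comment> \<open>Derivations use finitely many hypotheses, and these occur together at some stage.\<close>
  have fin: "\<exists>n. \<Gamma>' \<subseteq> f n" if "finite \<Gamma>'" "\<Gamma>' \<subseteq> ?\<Delta>" for \<Gamma>'
    using that
  proof induction
    case (insert \<phi> \<Gamma>')
    then obtain m n where "\<Gamma>' \<subseteq> f m" "\<phi> \<in> f n" by blast
    then have "insert \<phi> \<Gamma>' \<subseteq> f (max m n)"
      using mono[of m "max m n"] mono[of n "max m n"] by auto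
    then show ?case ..
  qed simp
  have "henkin T ?\<Delta>"
  proof
    show "consistent T ?\<Delta>"
    proof (rule ccontr)
      assume inc: "\<not> consistent T ?\<Delta>"
      have der: "\<exists>n. der T (f n) \<phi>" for \<phi>
      proof -
        from inc have "der T ?\<Delta> \<phi>" unfolding consistent_def by blast
        then obtain \<Gamma>' where *: "\<Gamma>' \<subseteq> ?\<Delta>" "finite \<Gamma>'" "der T \<Gamma>' \<phi>"
          using der_finite[of T ?\<Delta> \<phi>] by auto
        from fin[OF *(2,1)] der_mono[OF *(3)] show ?thesis by auto
      qed
      obtain m n where m: "der T (f m) (\<^bold>0 \<^bold>= \<^bold>0)" and n: "der T (f n) (\<^bold>\<not> \<^bold>0 \<^bold>= \<^bold>0)"
        using der by blast
      have "der T (f (max m n)) \<phi>" for \<phi>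
        using der_explode[OF der_mono[OF m mono] der_mono[OF n mono], of "max m n"] by simp
      with P[of "max m n"] show False unfolding consistent_def by blast
    qed
    show "settles ?\<Delta> \<phi>" for \<phi>
      by (rule settles_mono[of "f (Suc (to_nat \<phi>))"]) (use set[of "to_nat \<phi>"] in auto)
  qed
  moreover have "\<Gamma> \<subseteq> ?\<Delta>" using P by blast
  ultimately show thesis using that by blast
qed

context henkin
begin

lemma closed: "der T \<Delta> \<phi> \<Longrightarrow> \<phi> \<in> \<Delta>"
  using consistent settled[of \<phi>] unfolding consistent_def settles_def
  by (blast intro: der_explode hyp)

lemma provable_mem: "T \<turnstile> \<phi> \<Longrightarrow> \<phi> \<in> \<Delta>"
  by (rule closed[OF ax])

lemma Imp_memD: "(\<phi> \<^bold>\<longrightarrow> \<psi>) \<in> \<Delta> \<Longrightarrow> \<phi> \<in> \<Delta> \<Longrightarrow> \<psi> \<in> \<Delta>"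
  by (rule closed[OF mp[OF hyp hyp]])

lemma Neg_mem: "(\<^bold>\<not> \<phi>) \<in> \<Delta> \<longleftrightarrow> \<phi> \<notin> \<Delta>"
  using consistent settled[of \<phi>] unfolding consistent_def settles_def
  by (blast intro: der_explode hyp)

lemma Imp_mem: "(\<phi> \<^bold>\<longrightarrow> \<psi>) \<in> \<Delta> \<longleftrightarrow> (\<phi> \<in> \<Delta> \<longrightarrow> \<psi> \<in> \<Delta>)"
proof
  assume *: "\<phi> \<in> \<Delta> \<longrightarrow> \<psi> \<in> \<Delta>"
  show "(\<phi> \<^bold>\<longrightarrow> \<psi>) \<in> \<Delta>"
  proof (cases "\<phi> \<in> \<Delta>")
    case True
    with * show ?thesis by (auto intro: closed der_K hyp)
  next
    case False
    then have "(\<^bold>\<not> \<phi>) \<in> \<Delta>" by (simp add: Neg_mem)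
    then have "der T (insert \<phi> \<Delta>) \<psi>"
      by (intro der_explode[OF hyp hyp]) auto
    then show ?thesis by (rule closed[OF deduction])
  qed
qed (auto dest: Imp_memD)

lemma All_mem: "All \<phi> \<in> \<Delta> \<longleftrightarrow> (\<forall>t. inst t \<phi> \<in> \<Delta>)"
  using settled[of "All \<phi>"] Imp_memD[OF provable_mem[OF All_inst]]
  unfolding settles_def by (auto simp: Neg_mem)

lemma AllS_mem: "AllS \<phi> \<in> \<Delta> \<longleftrightarrow> (\<forall>Y. instS Y \<phi> \<in> \<Delta>)"
  using settled[of "AllS \<phi>"] Imp_memD[OF provable_mem[OF AllS_inst]]
  unfolding settles_def by (auto simp: Neg_mem)

definition eqv :: "(tm \<times> tm) set" where
  "eqv = {(s, t). (s \<^bold>= t) \<in> \<Delta>}"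

lemma replace: "(s, t) \<in> eqv \<Longrightarrow> inst s \<phi> \<in> \<Delta> \<Longrightarrow> inst t \<phi> \<in> \<Delta>"
  unfolding eqv_def using Imp_memD[OF Imp_memD[OF provable_mem[OF Leibniz]]] by blast

lemma inst_lift [simp]: "substt (case_nat s Var) (lift 1 t) = t"
  by (simp add: lift_1 substt_substt)

lemma eqv_refl: "(t, t) \<in> eqv"
  by (simp add: eqv_def provable_mem Refl)

lemma eqv_sym: "(s, t) \<in> eqv \<Longrightarrow> (t, s) \<in> eqv"
  using replace[of s t "Var 0 \<^bold>= lift 1 s"] eqv_refl[of s] by (simp add: inst_def eqv_def)

lemma eqv_trans: "(s, t) \<in> eqv \<Longrightarrow> (t, u) \<in> eqv \<Longrightarrow> (s, u) \<in> eqv"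
  using replace[of t u "lift 1 s \<^bold>= Var 0"] by (simp add: inst_def eqv_def)

lemma equiv_eqv: "equiv UNIV eqv"
  by (rule equivI) (auto simp: refl_on_def eqv_refl intro: symI transI eqv_sym eqv_trans)

lemma eqv_Add: "(s, s') \<in> eqv \<Longrightarrow> (t, t') \<in> eqv \<Longrightarrow> (s \<^bold>+ t, s' \<^bold>+ t') \<in> eqv"
  using replace[of s s' "lift 1 (s \<^bold>+ t) \<^bold>= Var 0 \<^bold>+ lift 1 t"]
    replace[of t t' "lift 1 (s \<^bold>+ t) \<^bold>= lift 1 s' \<^bold>+ Var 0"] eqv_refl[of "s \<^bold>+ t"]
  by (simp add: inst_def eqv_def)

lemma eqv_Mul: "(s, s') \<in> eqv \<Longrightarrow> (t, t') \<in> eqv \<Longrightarrow> (s \<^bold>* t, s' \<^bold>* t') \<in> eqv"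
  using replace[of s s' "lift 1 (s \<^bold>* t) \<^bold>= Var 0 \<^bold>* lift 1 t"]
    replace[of t t' "lift 1 (s \<^bold>* t) \<^bold>= lift 1 s' \<^bold>* Var 0"] eqv_refl[of "s \<^bold>* t"]
  by (simp add: inst_def eqv_def)

lemma eqv_Lt: "(s, s') \<in> eqv \<Longrightarrow> (t, t') \<in> eqv \<Longrightarrow> (s \<^bold>< t) \<in> \<Delta> \<Longrightarrow> (s' \<^bold>< t') \<in> \<Delta>"
  using replace[of s s' "Var 0 \<^bold>< lift 1 t"] replace[of t t' "lift 1 s' \<^bold>< Var 0"]
  by (simp add: inst_def)

lemma eqv_In: "(s, s') \<in> eqv \<Longrightarrow> (s \<^bold>\<in> X) \<in> \<Delta> \<Longrightarrow> (s' \<^bold>\<in> X) \<in> \<Delta>"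
  using replace[of s s' "Var 0 \<^bold>\<in> X"] by (simp add: inst_def)

text \<open>The numerals lie in distinct classes.\<close>

lemma infinite_quotient:
  assumes "basic_axioms \<subseteq> T"
  shows "infinite (UNIV // eqv)"
proof -
  define num where "num = rec_nat \<^bold>0 (\<lambda>_ t. t \<^bold>+ \<^bold>1)"
  have num [simp]: "num 0 = \<^bold>0" "num (Suc n) = num n \<^bold>+ \<^bold>1" for n
    by (simp_all add: num_def)
  have ba: "subst \<sigma> \<rho> \<phi> \<in> \<Delta>" if "\<phi> \<in> basic_axioms" for \<phi> \<sigma> \<rho>
    using assms that by (intro provable_mem provable_subst Axiom) blast
  have zero: "(num n \<^bold>+ \<^bold>1, \<^bold>0) \<notin> eqv" for n
    using ba[of "\<^bold>\<not> Var 1 \<^bold>+ \<^bold>1 \<^bold>= \<^bold>0" "\<lambda>_. num n" id]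
    by (simp add: basic_axioms_def Let_def eqv_def Neg_mem)
  have suc: "(num m \<^bold>+ \<^bold>1, num n \<^bold>+ \<^bold>1) \<in> eqv \<Longrightarrow> (num m, num n) \<in> eqv" for m n
    using ba[of "Var 0 \<^bold>+ \<^bold>1 \<^bold>= Var 1 \<^bold>+ \<^bold>1 \<^bold>\<longrightarrow> Var 0 \<^bold>= Var 1" "case_nat (num m) (\<lambda>_. num n)" id]
    by (simp add: basic_axioms_def Let_def eqv_def Imp_mem One_nat_def)
  have "m = n" if "(num m, num n) \<in> eqv" for m n
    using that
  proof (induction m arbitrary: n)
    case 0
    then show ?case using zero eqv_sym by (cases n) auto
  next
    case (Suc m)
    then show ?case using zero suc by (cases n) auto
  qed
  then have "inj (\<lambda>n. eqv `` {num n})"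
    by (intro injI) (auto dest: eq_equiv_class[OF _ equiv_eqv])
  then have "infinite (range (\<lambda>n. eqv `` {num n}))"
    by (rule range_inj_infinite)
  moreover have "range (\<lambda>n. eqv `` {num n}) \<subseteq> UNIV // eqv"
    by (auto intro: quotientI)
  ultimately show ?thesis
    using finite_subset by blast
qed

text \<open>There are countably infinitely many classes of terms, so they can be numbered bijectively by
  natural numbers; \<open>h\<close> maps a term to the number of its class. Stating the truth lemma for all
  substitutions makes the induction pass through the quantifiers.\<close>

lemma term_model:
  assumes "basic_axioms \<subseteq> T"
  obtains M :: "nat L2_structure" and S :: "nat \<Rightarrow> nat set" and h where "sets M = range S" "surj h"
    "\<And>\<sigma> \<rho> \<phi>. sat M (\<lambda>i. h (\<sigma> i)) (\<lambda>X. S (\<rho> X)) \<phi> \<longleftrightarrow> subst \<sigma> \<rho> \<phi> \<in> \<Delta>"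
proof -
  have "countable (UNIV // eqv)"
    unfolding quotient_def by auto
  then obtain b :: "tm set \<Rightarrow> nat" where b: "bij_betw b (UNIV // eqv) UNIV"
    using infinite_quotient[OF assms] by (rule countableE_infinite)
  define h where "h t = b (eqv `` {t})" for t
  have h_eq: "h s = h t \<longleftrightarrow> (s, t) \<in> eqv" for s t
  proof -
    have "h s = h t \<longleftrightarrow> eqv `` {s} = eqv `` {t}"
      unfolding h_def using bij_betw_imp_inj_on[OF b] by (simp add: inj_on_eq_iff quotientI)
    then show ?thesis
      by (simp add: eq_equiv_class_iff[OF equiv_eqv])
  qed
  have "surj h"
  proof
    show "UNIV \<subseteq> range h"
      using b unfolding bij_betw_def quotient_def h_def by auto
  qed simp
  define r where "r = inv h"
  have hr [simp]: "h (r x) = x" for x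
    by (simp add: r_def \<open>surj h\<close> surj_f_inv_f)
  have rh: "(r (h t), t) \<in> eqv" "(t, r (h t)) \<in> eqv" for t
    by (simp_all flip: h_eq)
  define S where "S X = {x. (r x \<^bold>\<in> X) \<in> \<Delta>}" for X
  define M where "M = \<lparr>zer = h \<^bold>0, uno = h \<^bold>1, plu = (\<lambda>x y. h (r x \<^bold>+ r y)),
    tim = (\<lambda>x y. h (r x \<^bold>* r y)), les = (\<lambda>x y. (r x \<^bold>< r y) \<in> \<Delta>), sets = range S\<rparr>"
  have plus: "h s \<oplus>\<^bsub>M\<^esub> h t = h (s \<^bold>+ t)" for s t
    by (simp add: M_def h_eq eqv_Add rh)
  have times: "h s \<otimes>\<^bsub>M\<^esub> h t = h (s \<^bold>* t)" for s t
    by (simp add: M_def h_eq eqv_Mul rh)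
  have less: "h s \<prec>\<^bsub>M\<^esub> h t \<longleftrightarrow> (s \<^bold>< t) \<in> \<Delta>" for s t
    unfolding M_def L2_structure.simps
    by (rule iffI[OF eqv_Lt[OF rh(1) rh(1)] eqv_Lt[OF rh(2) rh(2)]])
  have mem: "h t \<in> S X \<longleftrightarrow> (t \<^bold>\<in> X) \<in> \<Delta>" for t X
    unfolding S_def mem_Collect_eq by (rule iffI[OF eqv_In[OF rh(1)] eqv_In[OF rh(2)]])
  have const: "\<zero>\<^bsub>M\<^esub> = h \<^bold>0" "\<one>\<^bsub>M\<^esub> = h \<^bold>1" "sets M = range S"
    by (simp_all add: M_def)
  have eval: "evalt M (\<lambda>i. h (\<sigma> i)) t = h (substt \<sigma> t)" for \<sigma> t
    by (induction t) (simp_all add: plus times const)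
  have "sat M (\<lambda>i. h (\<sigma> i)) (\<lambda>X. S (\<rho> X)) \<phi> \<longleftrightarrow> subst \<sigma> \<rho> \<phi> \<in> \<Delta>" for \<sigma> \<rho> \<phi>
  proof (induction \<phi> arbitrary: \<sigma> \<rho>)
    case (All \<phi>)
    have cons: "case_nat (h t) (\<lambda>i. h (\<sigma> i)) = (\<lambda>i. h (case_nat t \<sigma> i))" for t
      by (auto split: nat.split)
    have "sat M (\<lambda>i. h (\<sigma> i)) (\<lambda>X. S (\<rho> X)) (All \<phi>) \<longleftrightarrow>
      (\<forall>t. sat M (case_nat (h t) (\<lambda>i. h (\<sigma> i))) (\<lambda>X. S (\<rho> X)) \<phi>)"
      unfolding sat.simps by (metis hr)
    then show ?case
      by (simp only: cons All.IH subst.simps All_mem inst_subst_up)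
  next
    case (AllS \<phi>)
    have cons: "case_nat (S Y) (\<lambda>X. S (\<rho> X)) = (\<lambda>X. S (case_nat Y \<rho> X))" for Y
      by (rule ext) (simp split: nat.split)
    have "sat M (\<lambda>i. h (\<sigma> i)) (\<lambda>X. S (\<rho> X)) (AllS \<phi>) \<longleftrightarrow>
      (\<forall>Y. sat M (\<lambda>i. h (\<sigma> i)) (case_nat (S Y) (\<lambda>X. S (\<rho> X))) \<phi>)"
      by (simp add: const)
    then show ?case
      by (simp only: cons AllS.IH subst.simps AllS_mem instS_subst_upS)
  qed (simp_all add: eval h_eq less mem Neg_mem Imp_mem, simp add: eqv_def)
  with const(3) \<open>surj h\<close> show thesis by (rule that)
qed

end

text \<open>The enumeration \<open>S\<close> of the sets is part of the conclusion because it makes every set of the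
  model the value of a set variable under one fixed assignment.\<close>

theorem countable_model:
  assumes "basic_axioms \<subseteq> T" "\<not> (T \<turnstile> \<phi>)"
  obtains M :: "nat L2_structure" and S :: "nat \<Rightarrow> nat set" and e r where "sets M = range S"
    "\<And>\<psi> e r. \<psi> \<in> T \<Longrightarrow> range r \<subseteq> sets M \<Longrightarrow> sat M e r \<psi>"
    "range r \<subseteq> sets M" "\<not> sat M e r \<phi>"
proof -
  have "\<not> der T {} \<phi>"
    using assms(2) der_empty by blast
  then have "consistent T {\<^bold>\<not> \<phi>}"
    by (intro consistent_insert) (auto simp: consistent_def)
  then obtain \<Delta> where \<Delta>: "{\<^bold>\<not> \<phi>} \<subseteq> \<Delta>" "henkin T \<Delta>"
    by (rule henkin_extension[rotated]) simp_all
  interpret henkin T \<Delta> by fact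
  obtain M :: "nat L2_structure" and S h where M: "sets M = range S" "surj h"
    "\<And>\<sigma> \<rho> \<phi>. sat M (\<lambda>i. h (\<sigma> i)) (\<lambda>X. S (\<rho> X)) \<phi> \<longleftrightarrow> subst \<sigma> \<rho> \<phi> \<in> \<Delta>"
    using term_model[OF assms(1)] by blast
  show thesis
  proof (rule that[OF M(1)])
    \<comment> \<open>Every assignment arises from a substitution, and axioms are provable in all instances.\<close>
    fix \<psi> and e :: "nat \<Rightarrow> nat" and r :: "nat \<Rightarrow> nat set"
    assume "\<psi> \<in> T" "range r \<subseteq> sets M"
    then have "\<forall>X. \<exists>Y. r X = S Y"
      by (auto simp: M(1))
    then obtain \<rho> where "r = (\<lambda>X. S (\<rho> X))"
      by (metis ext)
    moreover have "e = (\<lambda>i. h (inv h (e i)))"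
      by (simp add: M(2) surj_f_inv_f)
    ultimately show "sat M e r \<psi>"
      using M(3)[of "\<lambda>i. inv h (e i)" \<rho> \<psi>] provable_mem[OF provable_subst[OF Axiom[OF \<open>\<psi> \<in> T\<close>]]]
      by simp
  next
    show "range S \<subseteq> sets M" by (simp add: M(1))
    show "\<not> sat M (\<lambda>i. h (Var i)) S \<phi>"
      using M(3)[of Var "\<lambda>X. X" \<phi>] \<Delta>(1) Neg_mem[of \<phi>] by simp
  qed
qed

section \<open>Definability in a model of the base system\<close>

lemma evalt_substt: "evalt M e (substt \<sigma> t) = evalt M (\<lambda>i. evalt M e (\<sigma> i)) t"
  by (induction t) simp_all

lemma evalt_lift_1 [simp]: "evalt M (case_nat x e) (lift 1 t) = evalt M e t"
  by (simp add: lift_1 evalt_substt)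

lemma sat_subst:
  "sat M e r (subst \<sigma> \<rho> \<phi>) \<longleftrightarrow> sat M (\<lambda>i. evalt M e (\<sigma> i)) (\<lambda>X. r (\<rho> X)) \<phi>"
proof (induction \<phi> arbitrary: e r \<sigma> \<rho>)
  case (All \<phi>)
  have "(\<lambda>i. evalt M (case_nat x e) (up \<sigma> i)) = case_nat x (\<lambda>i. evalt M e (\<sigma> i))" for x
    by (rule ext) (simp split: nat.split)
  with All show ?case by simp
next
  case (AllS \<phi>)
  have "(\<lambda>X. case_nat A r (upS \<rho> X)) = case_nat A (\<lambda>X. r (\<rho> X))" for A
    by (rule ext) (simp split: nat.split)
  with AllS show ?case by simp
qed (simp_all add: evalt_substt)

lemma sat_BAll [simp]:
  "sat M e r (BAll t \<phi>) \<longleftrightarrow> (\<forall>x. x \<prec>\<^bsub>M\<^esub> evalt M e t \<longrightarrow> sat M (case_nat x e) r \<phi>)"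
  by (simp add: BAll_def)

lemma sat_BEx [simp]:
  "sat M e r (BEx t \<phi>) \<longleftrightarrow> (\<exists>x. x \<prec>\<^bsub>M\<^esub> evalt M e t \<and> sat M (case_nat x e) r \<phi>)"
  by (simp add: BEx_def)

lemma subst_BAll: "subst \<sigma> \<rho> (BAll t \<phi>) = BAll (substt \<sigma> t) (subst (up \<sigma>) \<rho> \<phi>)"
  by (simp add: BAll_def substt_up_lift)

lemma subst_BEx: "subst \<sigma> \<rho> (BEx t \<phi>) = BEx (substt \<sigma> t) (subst (up \<sigma>) \<rho> \<phi>)"
  by (simp add: BEx_def substt_up_lift)

lemma bounded_subst: "bounded \<phi> \<Longrightarrow> bounded (subst \<sigma> \<rho> \<phi>)"
  by (induction arbitrary: \<sigma> \<rho> rule: bounded.induct)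
    (simp_all add: subst_BAll subst_BEx bounded.intros)

text \<open>The universe is enumerated by \<open>cst\<close> and the family of sets by \<open>S\<close>. All elements and sets of
  the model can thus be parameters of formulas evaluated under one fixed assignment.\<close>

locale RCA0_model =
  fixes M :: "'a L2_structure" (structure) and cst :: "nat \<Rightarrow> 'a" and S :: "nat \<Rightarrow> 'a set"
  assumes surj_cst: "surj cst"
    and sets_eq: "sets M = range S"
    and RCA0: "\<phi> \<in> RCA0 \<Longrightarrow> range r \<subseteq> sets M \<Longrightarrow> sat M e r \<phi>"
begin

text \<open>The assignment that reads the even variables from \<open>e\<close> and lets the odd ones name all elements
  of the universe.\<close>

definition mix :: "(nat \<Rightarrow> 'a) \<Rightarrow> nat \<Rightarrow> 'a" where
  "mix e i = (if even i then e (i div 2) else cst (i div 2))"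

text \<open>Definability of functions and predicates of assignments, with arbitrary elements and sets
  of the model as parameters. Variables are addressed by de Bruijn indices, so that the closure
  rules below can be applied to a formula by higher-order unification.\<close>

definition Term :: "((nat \<Rightarrow> 'a) \<Rightarrow> 'a) \<Rightarrow> bool" where
  "Term f \<longleftrightarrow> (\<exists>t. \<forall>e. f e = evalt M (mix e) t)"

definition Delta0 :: "((nat \<Rightarrow> 'a) \<Rightarrow> bool) \<Rightarrow> bool" where
  "Delta0 P \<longleftrightarrow> (\<exists>\<theta>. bounded \<theta> \<and> (\<forall>e. P e \<longleftrightarrow> sat M (mix e) S \<theta>))"

definition Sigma1 :: "((nat \<Rightarrow> 'a) \<Rightarrow> bool) \<Rightarrow> bool" where
  "Sigma1 P \<longleftrightarrow> (\<exists>\<theta>. bounded \<theta> \<and> (\<forall>e. P e \<longleftrightarrow> sat M (mix e) S (Ex \<theta>)))"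

text \<open>Pushing a value on \<open>e\<close> permutes the even and odd variables in a way that does not depend on
  the values.\<close>

lemma mix_case_nat: "\<exists>\<pi>. \<forall>x e. mix (case_nat x e) = (\<lambda>i. case_nat x (mix e) (\<pi> i))"
proof (intro exI allI)
  fix x e
  have "mix (case_nat x e) i =
    case_nat x (mix e) (if i = 0 then 0 else if even i then i - 1 else i + 1)" for i
  proof -
    consider "i = 0" | k where "i = Suc (Suc (2 * k))" | k where "i = Suc (2 * k)"
      by (metis evenE oddE Suc_eq_plus1 mult_Suc_right add_2_eq_Suc not0_implies_Suc mult_0_right)
    then show ?thesis by cases (simp_all add: mix_def)
  qed
  then show "mix (case_nat x e) =
    (\<lambda>i. case_nat x (mix e) (if i = 0 then 0 else if even i then i - 1 else i + 1))" ..
qed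

lemma Term_var: "Term (\<lambda>e. e k)"
  unfolding Term_def by (rule exI[of _ "Var (2 * k)"]) (simp add: mix_def)

lemma Term_const: "Term (\<lambda>e. a)"
proof -
  obtain k where "a = cst k" using surj_cst by (rule surjE)
  then show ?thesis
    unfolding Term_def by (intro exI[of _ "Var (2 * k + 1)"]) (simp add: mix_def)
qed

lemma Term_plus: "Term f \<Longrightarrow> Term g \<Longrightarrow> Term (\<lambda>e. f e \<oplus> g e)"
  unfolding Term_def by (metis evalt.simps(4))

lemma Term_times: "Term f \<Longrightarrow> Term g \<Longrightarrow> Term (\<lambda>e. f e \<otimes> g e)"
  unfolding Term_def by (metis evalt.simps(5))

lemma Delta0_sat:
  assumes "bounded \<theta>" "\<And>i. Term (\<sigma> i)" "range r \<subseteq> sets M"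
  shows "Delta0 (\<lambda>e. sat M (\<lambda>i. \<sigma> i e) r \<theta>)"
proof -
  have "\<forall>i. \<exists>t. \<forall>e. \<sigma> i e = evalt M (mix e) t"
    using assms(2) by (auto simp: Term_def)
  then obtain \<tau> where \<tau>: "\<And>i e. \<sigma> i e = evalt M (mix e) (\<tau> i)"
    by metis
  have "\<forall>X. \<exists>Y. r X = S Y"
    using assms(3) by (auto simp: sets_eq)
  then obtain \<rho> where \<rho>: "\<And>X. r X = S (\<rho> X)"
    by metis
  have "sat M (\<lambda>i. \<sigma> i e) r \<theta> \<longleftrightarrow> sat M (mix e) S (subst \<tau> \<rho> \<theta>)" for e
    by (simp add: sat_subst flip: \<tau> \<rho>)
  with bounded_subst[OF assms(1)] show ?thesis
    unfolding Delta0_def by blast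
qed

text \<open>Substitution of definable functions for variables: a definability proof for a predicate of
  variables serves for all arguments.\<close>

lemma Delta0_subst:
  assumes "Delta0 P" "\<And>i. Term (\<sigma> i)"
  shows "Delta0 (\<lambda>e. P (\<lambda>i. \<sigma> i e))"
proof -
  obtain \<theta> where \<theta>: "bounded \<theta>" "\<And>e. P e \<longleftrightarrow> sat M (mix e) S \<theta>"
    using assms(1) unfolding Delta0_def by blast
  have "Term (\<lambda>e. mix (\<lambda>i. \<sigma> i e) i)" for i
    unfolding mix_def by (cases "even i") (simp_all add: assms(2) Term_const)
  then have "Delta0 (\<lambda>e. sat M (\<lambda>i. mix (\<lambda>i. \<sigma> i e) i) S \<theta>)"
    by (intro Delta0_sat \<theta>(1)) (simp_all add: sets_eq)
  then show ?thesis by (simp add: \<theta>(2))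
qed

lemma Delta0_binary:
  assumes "Delta0 (\<lambda>e. K (e 0) (e 1))" "Term f" "Term g"
  shows "Delta0 (\<lambda>e. K (f e) (g e))"
  using Delta0_subst[OF assms(1), of "\<lambda>i. if i = 0 then f else g"] assms(2,3) by simp

lemma Delta0_ternary:
  assumes "Delta0 (\<lambda>e. K (e 0) (e 1) (e 2))" "Term f" "Term g" "Term h"
  shows "Delta0 (\<lambda>e. K (f e) (g e) (h e))"
  using Delta0_subst[OF assms(1), of "\<lambda>i. if i = 0 then f else if i = 1 then g else h"] assms(2-)
  by simp

lemma Delta0_eq: "Term f \<Longrightarrow> Term g \<Longrightarrow> Delta0 (\<lambda>e. f e = g e)"
  unfolding Term_def Delta0_def by (metis bounded.intros(1) sat.simps(1))

lemma Delta0_less: "Term f \<Longrightarrow> Term g \<Longrightarrow> Delta0 (\<lambda>e. f e \<prec> g e)"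
  unfolding Term_def Delta0_def by (metis bounded.intros(2) sat.simps(2))

lemma Delta0_mem: "Term f \<Longrightarrow> A \<in> sets M \<Longrightarrow> Delta0 (\<lambda>e. f e \<in> A)"
  unfolding Term_def Delta0_def sets_eq by (metis bounded.intros(3) sat.simps(3) rangeE)

lemma Delta0_not: "Delta0 P \<Longrightarrow> Delta0 (\<lambda>e. \<not> P e)"
  unfolding Delta0_def by (metis bounded.intros(4) sat.simps(4))

lemma Delta0_imp: "Delta0 P \<Longrightarrow> Delta0 Q \<Longrightarrow> Delta0 (\<lambda>e. P e \<longrightarrow> Q e)"
  unfolding Delta0_def by (metis bounded.intros(5) sat.simps(5))

lemma Delta0_conj: "Delta0 P \<Longrightarrow> Delta0 Q \<Longrightarrow> Delta0 (\<lambda>e. P e \<and> Q e)"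
  using Delta0_not[OF Delta0_imp[OF _ Delta0_not]] by simp

lemma Delta0_disj: "Delta0 P \<Longrightarrow> Delta0 Q \<Longrightarrow> Delta0 (\<lambda>e. P e \<or> Q e)"
  using Delta0_imp[OF Delta0_not] by (simp add: disj_imp)

text \<open>Brings the head of the assignment to variable 0, where a quantifier can bind it.\<close>

lemma Delta0_head:
  assumes "Delta0 (\<lambda>e. Q (\<lambda>i. e (Suc i)) (e 0))"
  shows "\<exists>\<theta>. bounded \<theta> \<and> (\<forall>e x. Q e x \<longleftrightarrow> sat M (case_nat x (mix e)) S \<theta>)"
proof -
  obtain \<theta> where \<theta>: "bounded \<theta>" "\<And>e. Q (\<lambda>i. e (Suc i)) (e 0) \<longleftrightarrow> sat M (mix e) S \<theta>"
    using assms unfolding Delta0_def by blast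
  obtain \<pi> where \<pi>: "\<And>x e. mix (case_nat x e) = (\<lambda>i. case_nat x (mix e) (\<pi> i))"
    using mix_case_nat by blast
  show ?thesis
  proof (intro exI conjI allI)
    show "bounded (subst (\<lambda>i. Var (\<pi> i)) (\<lambda>X. X) \<theta>)"
      using \<theta>(1) by (rule bounded_subst)
    show "Q e x \<longleftrightarrow> sat M (case_nat x (mix e)) S (subst (\<lambda>i. Var (\<pi> i)) (\<lambda>X. X) \<theta>)" for e x
      using \<theta>(2)[of "case_nat x e"] by (simp add: sat_subst \<pi>)
  qed
qed

lemma Delta0_ball:
  assumes "Term f" "Delta0 (\<lambda>e. Q (\<lambda>i. e (Suc i)) (e 0))"
  shows "Delta0 (\<lambda>e. \<forall>x. x \<prec> f e \<longrightarrow> Q e x)"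
proof -
  obtain \<theta> where "bounded \<theta>" "\<And>e x. Q e x \<longleftrightarrow> sat M (case_nat x (mix e)) S \<theta>"
    using Delta0_head[OF assms(2)] by blast
  moreover obtain t where "\<And>e. f e = evalt M (mix e) t"
    using assms(1) unfolding Term_def by blast
  ultimately show ?thesis
    unfolding Delta0_def by (intro exI[of _ "BAll t \<theta>"]) (simp add: bounded.intros)
qed

lemma Delta0_bex:
  assumes "Term f" "Delta0 (\<lambda>e. Q (\<lambda>i. e (Suc i)) (e 0))"
  shows "Delta0 (\<lambda>e. \<exists>x. x \<prec> f e \<and> Q e x)"
proof -
  obtain \<theta> where "bounded \<theta>" "\<And>e x. Q e x \<longleftrightarrow> sat M (case_nat x (mix e)) S \<theta>"
    using Delta0_head[OF assms(2)] by blast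
  moreover obtain t where "\<And>e. f e = evalt M (mix e) t"
    using assms(1) unfolding Term_def by blast
  ultimately show ?thesis
    unfolding Delta0_def by (intro exI[of _ "BEx t \<theta>"]) (simp add: bounded.intros)
qed

lemma Sigma1_ex:
  assumes "Delta0 (\<lambda>e. Q (\<lambda>i. e (Suc i)) (e 0))"
  shows "Sigma1 (\<lambda>e. \<exists>x. Q e x)"
proof -
  obtain \<theta> where "bounded \<theta>" "\<And>e x. Q e x \<longleftrightarrow> sat M (case_nat x (mix e)) S \<theta>"
    using Delta0_head[OF assms] by blast
  then show ?thesis
    unfolding Sigma1_def by (intro exI[of _ \<theta>]) auto
qed

lemmas definable = Term_var Term_const Term_plus Term_times
  Delta0_eq Delta0_less Delta0_mem Delta0_ball Delta0_bex Delta0_not Delta0_conj Delta0_disj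
  Delta0_imp

text \<open>The assignment to the variables other than 0 when a predicate of one argument is evaluated.
  The odd variables name the elements of the model; the values of the even ones are arbitrary.\<close>

abbreviation env :: "nat \<Rightarrow> 'a" where
  "env \<equiv> \<lambda>i. mix cst (Suc i)"

lemma Sigma1_unary:
  assumes "Sigma1 (\<lambda>e. P (e 0))"
  shows "\<exists>\<phi>\<in>Sigma01. \<forall>x. sat M (case_nat x env) S \<phi> \<longleftrightarrow> P x"
proof -
  obtain \<theta> where \<theta>: "bounded \<theta>" "\<And>e. P (e 0) \<longleftrightarrow> sat M (mix e) S (Ex \<theta>)"
    using assms unfolding Sigma1_def by blast
  have "case_nat x env = mix (case_nat x (\<lambda>i. cst (Suc i)))" for x
    by (rule ext) (auto simp: mix_def elim!: oddE evenE split: nat.split)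
  then have "\<forall>x. sat M (case_nat x env) S (Ex \<theta>) \<longleftrightarrow> P x"
    by (simp del: sat.simps flip: \<theta>(2))
  with \<theta>(1) show ?thesis unfolding Sigma01_def by blast
qed

lemma Sigma1_induct [case_names definable zero succ]:
  assumes "Sigma1 (\<lambda>e. P (e 0))" "P \<zero>" "\<And>n. P n \<Longrightarrow> P (n \<oplus> \<one>)"
  shows "P n"
proof -
  obtain \<phi> where \<phi>: "\<phi> \<in> Sigma01" "\<And>x. sat M (case_nat x env) S \<phi> \<longleftrightarrow> P x"
    using Sigma1_unary[OF assms(1)] by blast
  have "induction_axiom \<phi> \<in> RCA0"
    using \<phi>(1) by (auto simp: RCA0_def)
  then have ia: "sat M env S (induction_axiom \<phi>)"
    by (rule RCA0) (simp add: sets_eq)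
  have zero: "sat M env S (inst \<^bold>0 \<phi>) \<longleftrightarrow> P \<zero>"
  proof -
    have "(\<lambda>i. evalt M env (case_nat \<^bold>0 Var i)) = case_nat \<zero> env"
      by (rule ext) (simp split: nat.split)
    then show ?thesis by (simp only: inst_def sat_subst \<phi>(2))
  qed
  have succ: "sat M (case_nat x env) S
    (subst (case_nat (Var 0 \<^bold>+ \<^bold>1) (\<lambda>i. Var (Suc i))) (\<lambda>X. X) \<phi>) \<longleftrightarrow> P (x \<oplus> \<one>)" for x
  proof -
    have "(\<lambda>i. evalt M (case_nat x env) (case_nat (Var 0 \<^bold>+ \<^bold>1) (\<lambda>i. Var (Suc i)) i))
      = case_nat (x \<oplus> \<one>) env"
      by (rule ext) (simp split: nat.split)
    then show ?thesis by (simp only: sat_subst \<phi>(2))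
  qed
  have "P \<zero> \<and> (\<forall>x. P x \<longrightarrow> P (x \<oplus> \<one>)) \<longrightarrow> (\<forall>x. P x)"
    using ia unfolding induction_axiom_def sat.simps \<phi>(2) zero succ not_imp not_not .
  with assms(2,3) show ?thesis by blast
qed

lemma Delta1_comprehension:
  assumes "Sigma1 (\<lambda>e. P (e 0))" "Sigma1 (\<lambda>e. \<not> P (e 0))"
  shows "{n. P n} \<in> sets M"
proof -
  obtain \<phi> where \<phi>: "\<phi> \<in> Sigma01" "\<And>x. sat M (case_nat x env) S \<phi> \<longleftrightarrow> P x"
    using Sigma1_unary[OF assms(1)] by blast
  obtain \<psi> where \<psi>: "\<psi> \<in> Sigma01" "\<And>x. sat M (case_nat x env) S \<psi> \<longleftrightarrow> \<not> P x"
    using Sigma1_unary[OF assms(2)] by blast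
  obtain \<theta> where \<theta>: "bounded \<theta>" "\<psi> = Ex \<theta>"
    using \<psi>(1) unfolding Sigma01_def by blast
  have neg: "(\<forall>y. \<not> sat M (case_nat y (case_nat x env)) S \<theta>) \<longleftrightarrow> P x" for x
    using \<psi>(2)[of x] \<theta>(2) by auto
  have "comprehension_axiom \<phi> (All (\<^bold>\<not> \<theta>)) \<in> RCA0"
    using \<phi>(1) bounded.intros(4)[OF \<theta>(1)] unfolding RCA0_def Pi01_def by blast
  then have "sat M env S (comprehension_axiom \<phi> (All (\<^bold>\<not> \<theta>)))"
    by (rule RCA0) (simp add: sets_eq)
  then have "\<exists>A\<in>sets M. \<forall>x. x \<in> A \<longleftrightarrow> P x"
    unfolding comprehension_axiom_def liftS_fm_def by (simp add: sat_subst \<phi>(2) neg) blast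
  then obtain A where "A \<in> sets M" "\<forall>x. x \<in> A \<longleftrightarrow> P x" by blast
  then show ?thesis
    by (metis Collect_cong Collect_mem_eq)
qed

lemma Sigma1_Delta0: assumes "Delta0 P" shows "Sigma1 P"
proof -
  obtain \<theta> where \<theta>: "bounded \<theta>" "\<And>e. P e \<longleftrightarrow> sat M (mix e) S \<theta>"
    using assms unfolding Delta0_def by blast
  then have "\<forall>e. P e \<longleftrightarrow> sat M (mix e) S (Ex (lift_fm \<theta>))"
    by (simp add: lift_fm_def sat_subst)
  then show ?thesis
    unfolding Sigma1_def using bounded_subst[OF \<theta>(1)] unfolding lift_fm_def by blast
qed

lemma Delta0_set: "Delta0 (\<lambda>e. P (e 0)) \<Longrightarrow> {n. P n} \<in> sets M"
  by (intro Delta1_comprehension Sigma1_Delta0 Delta0_not)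

lemma Delta0_induct [case_names definable zero succ]:
  assumes "Delta0 (\<lambda>e. P (e 0))" "P \<zero>" "\<And>n. P n \<Longrightarrow> P (n \<oplus> \<one>)"
  shows "P n"
  using Sigma1_Delta0[OF assms(1)] assms(2,3) by (rule Sigma1_induct)

section \<open>Arithmetic\<close>

lemma basic_axiom: "\<phi> \<in> basic_axioms \<Longrightarrow> sat M (case_nat m (\<lambda>_. n)) S \<phi>"
  by (rule RCA0) (auto simp: RCA0_def sets_eq)

lemma
  shows succ_ne_zero: "n \<oplus> \<one> \<noteq> \<zero>"
    and succ_inject: "m \<oplus> \<one> = n \<oplus> \<one> \<Longrightarrow> m = n"
    and add_zero: "m \<oplus> \<zero> = m"
    and add_succ: "m \<oplus> (n \<oplus> \<one>) = (m \<oplus> n) \<oplus> \<one>"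
    and mult_zero: "m \<otimes> \<zero> = \<zero>"
    and mult_succ: "m \<otimes> (n \<oplus> \<one>) = (m \<otimes> n) \<oplus> m"
    and not_less_zero: "\<not> m \<prec> \<zero>"
    and less_succ: "m \<prec> n \<oplus> \<one> \<longleftrightarrow> m \<prec> n \<or> m = n"
proof -
  have "\<forall>\<phi>\<in>basic_axioms. sat M (case_nat m (\<lambda>_. n)) S \<phi>"
    using basic_axiom by blast
  then show "n \<oplus> \<one> \<noteq> \<zero>" "m \<oplus> \<one> = n \<oplus> \<one> \<Longrightarrow> m = n" "m \<oplus> \<zero> = m"
    "m \<oplus> (n \<oplus> \<one>) = (m \<oplus> n) \<oplus> \<one>" "m \<otimes> \<zero> = \<zero>"
    "m \<otimes> (n \<oplus> \<one>) = (m \<otimes> n) \<oplus> m" "\<not> m \<prec> \<zero>" "m \<prec> n \<oplus> \<one> \<longleftrightarrow> m \<prec> n \<or> m = n"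
    unfolding basic_axioms_def Let_def by (auto simp: One_nat_def)
qed

lemma zero_add: "\<zero> \<oplus> n = n"
proof (induction n rule: Delta0_induct)
  show "Delta0 (\<lambda>e. \<zero> \<oplus> e 0 = e 0)" by (intro definable)
qed (simp_all add: add_zero add_succ)

lemma succ_add: "(m \<oplus> \<one>) \<oplus> n = (m \<oplus> n) \<oplus> \<one>"
proof (induction n rule: Delta0_induct)
  show "Delta0 (\<lambda>e. (m \<oplus> \<one>) \<oplus> e 0 = (m \<oplus> e 0) \<oplus> \<one>)" by (intro definable)
qed (simp_all add: add_zero add_succ)

lemma add_commute: "m \<oplus> n = n \<oplus> m"
proof (induction n rule: Delta0_induct)
  show "Delta0 (\<lambda>e. m \<oplus> e 0 = e 0 \<oplus> m)" by (intro definable)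
qed (simp_all add: add_zero zero_add add_succ succ_add)

lemma add_assoc: "(k \<oplus> m) \<oplus> n = k \<oplus> (m \<oplus> n)"
proof (induction n rule: Delta0_induct)
  show "Delta0 (\<lambda>e. (k \<oplus> m) \<oplus> e 0 = k \<oplus> (m \<oplus> e 0))" by (intro definable)
qed (simp_all add: add_zero add_succ)

lemma add_left_commute: "k \<oplus> (m \<oplus> n) = m \<oplus> (k \<oplus> n)"
  by (metis add_assoc add_commute)

lemma add_left_cancel: "k \<oplus> m = k \<oplus> n \<longleftrightarrow> m = n"
proof
  show "k \<oplus> m = k \<oplus> n \<Longrightarrow> m = n"
  proof (induction k rule: Delta0_induct)
    show "Delta0 (\<lambda>e. e 0 \<oplus> m = e 0 \<oplus> n \<longrightarrow> m = n)" by (intro definable)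
  qed (simp_all add: zero_add, metis succ_add succ_inject)
qed simp

lemma less_iff_add: "x \<prec> y \<longleftrightarrow> (\<exists>k. y = x \<oplus> (k \<oplus> \<one>))"
proof
  assume "x \<prec> y"
  \<comment> \<open>With the quantifier in front of the implication, the induction formula is Sigma-1.\<close>
  have "\<exists>k. x \<prec> y \<longrightarrow> y = x \<oplus> (k \<oplus> \<one>)"
  proof (induction y rule: Sigma1_induct)
    show "Sigma1 (\<lambda>e. \<exists>k. x \<prec> e 0 \<longrightarrow> e 0 = x \<oplus> (k \<oplus> \<one>))"
      by (rule Sigma1_ex) (intro definable)
  next
    case (succ y)
    then obtain k where k: "x \<prec> y \<longrightarrow> y = x \<oplus> (k \<oplus> \<one>)" ..
    show ?case
    proof (cases "x = y")
      case True
      then show ?thesis by (intro exI[of _ \<zero>]) (simp add: zero_add)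
    next
      case False
      with k show ?thesis by (intro exI[of _ "k \<oplus> \<one>"]) (auto simp: less_succ add_succ)
    qed
  qed (simp add: not_less_zero)
  with \<open>x \<prec> y\<close> show "\<exists>k. y = x \<oplus> (k \<oplus> \<one>)" by blast
next
  assume "\<exists>k. y = x \<oplus> (k \<oplus> \<one>)"
  moreover have "x \<prec> x \<oplus> (k \<oplus> \<one>)" for k
  proof (induction k rule: Delta0_induct)
    show "Delta0 (\<lambda>e. x \<prec> x \<oplus> (e 0 \<oplus> \<one>))" by (intro definable)
  qed (simp_all add: zero_add add_succ less_succ)
  ultimately show "x \<prec> y" by blast
qed

text \<open>The cases of zero and successor, obtained from the order because the disjunction on the right
  is unbounded as it stands.\<close>

lemma zero_or_succ: "n = \<zero> \<or> (\<exists>k. n = k \<oplus> \<one>)"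
proof -
  have "n = \<zero> \<or> \<zero> \<prec> n"
  proof (induction n rule: Delta0_induct)
    show "Delta0 (\<lambda>e. e 0 = \<zero> \<or> \<zero> \<prec> e 0)" by (intro definable)
  qed (auto simp: less_succ)
  then show ?thesis by (simp add: less_iff_add zero_add)
qed

lemma less_trans: "x \<prec> y \<Longrightarrow> y \<prec> z \<Longrightarrow> x \<prec> z"
  unfolding less_iff_add by (metis add_assoc)

lemma less_irrefl: "\<not> x \<prec> x"
  unfolding less_iff_add by (metis add_left_cancel add_zero succ_ne_zero)

lemma less_linear: "x \<prec> y \<or> x = y \<or> y \<prec> x"
proof (induction x rule: Delta0_induct)
  show "Delta0 (\<lambda>e. e 0 \<prec> y \<or> e 0 = y \<or> y \<prec> e 0)" by (intro definable)
next
  case zero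
  show ?case using zero_or_succ[of y] by (auto simp: less_iff_add zero_add)
next
  case (succ x)
  have "x \<oplus> \<one> \<prec> y \<or> x \<oplus> \<one> = y" if less: "x \<prec> y"
  proof -
    obtain k where k: "y = x \<oplus> (k \<oplus> \<one>)" using less unfolding less_iff_add by blast
    from zero_or_succ[of k] show ?thesis
    proof
      assume "k = \<zero>"
      then show ?thesis by (simp add: k zero_add)
    next
      assume "\<exists>j. k = j \<oplus> \<one>"
      then obtain j where "k = j \<oplus> \<one>" ..
      then have "y = (x \<oplus> \<one>) \<oplus> (j \<oplus> \<one>)"
        unfolding k by (metis succ_add add_succ)
      then show ?thesis unfolding less_iff_add by blast
    qed
  qed
  with succ show ?case by (auto simp: less_succ)
qed

abbreviation le (infix "\<preceq>" 50) where "x \<preceq> y \<equiv> x \<prec> y \<or> x = y"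

lemma le_less_trans: "x \<preceq> y \<Longrightarrow> y \<prec> z \<Longrightarrow> x \<prec> z"
  using less_trans by blast

lemma less_le_trans: "x \<prec> y \<Longrightarrow> y \<preceq> z \<Longrightarrow> x \<prec> z"
  using less_trans by blast

lemma le_trans: "x \<preceq> y \<Longrightarrow> y \<preceq> z \<Longrightarrow> x \<preceq> z"
  using less_trans by blast

lemma le_add1: "x \<preceq> x \<oplus> y"
  using zero_or_succ[of y] by (auto simp: less_iff_add add_zero)

lemma le_add2: "y \<preceq> x \<oplus> y"
  using le_add1[of y x] by (simp add: add_commute)

lemma add_left_mono: "x \<preceq> y \<Longrightarrow> k \<oplus> x \<preceq> k \<oplus> y"
  unfolding less_iff_add by (metis add_assoc)

lemma succ_le: "x \<prec> y \<Longrightarrow> x \<oplus> \<one> \<preceq> y"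
  using less_linear less_succ less_trans less_irrefl by blast

lemma succ_mult: "(m \<oplus> \<one>) \<otimes> n = (m \<otimes> n) \<oplus> n"
proof (induction n rule: Delta0_induct)
  show "Delta0 (\<lambda>e. (m \<oplus> \<one>) \<otimes> e 0 = (m \<otimes> e 0) \<oplus> e 0)" by (intro definable)
next
  case (succ n)
  have "(m \<oplus> \<one>) \<otimes> (n \<oplus> \<one>) = ((m \<otimes> n) \<oplus> n) \<oplus> (m \<oplus> \<one>)"
    by (simp only: mult_succ succ)
  also have "\<dots> = ((m \<otimes> n) \<oplus> m) \<oplus> (n \<oplus> \<one>)"
    by (simp only: add_assoc add_left_commute)
  finally show ?case by (simp only: mult_succ)
qed (simp add: mult_zero add_zero)

lemma square_succ: "(n \<oplus> \<one>) \<otimes> (n \<oplus> \<one>) = ((n \<otimes> n) \<oplus> n) \<oplus> (n \<oplus> \<one>)"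
  by (simp only: mult_succ succ_mult)

lemma le_square: "n \<preceq> n \<otimes> n"
proof (induction n rule: Delta0_induct)
  show "Delta0 (\<lambda>e. e 0 \<prec> e 0 \<otimes> e 0 \<or> e 0 = e 0 \<otimes> e 0)" by (intro definable)
next
  case (succ n)
  show ?case using le_add2[of "n \<oplus> \<one>" "(n \<otimes> n) \<oplus> n"] by (simp only: square_succ)
qed (simp add: mult_zero)

text \<open>Consecutive squares are so far apart that \<open>m * m + s\<close> with \<open>s \<le> m\<close> determines \<open>m\<close>; this is
  why the pairing is injective.\<close>

lemma square_gap: "m \<prec> n \<Longrightarrow> (m \<otimes> m) \<oplus> m \<prec> n \<otimes> n"
proof (induction n rule: Delta0_induct)
  show "Delta0 (\<lambda>e. m \<prec> e 0 \<longrightarrow> (m \<otimes> m) \<oplus> m \<prec> e 0 \<otimes> e 0)" by (intro definable)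
next
  case (succ n)
  have *: "(n \<otimes> n) \<oplus> n \<prec> (n \<oplus> \<one>) \<otimes> (n \<oplus> \<one>)"
    unfolding square_succ less_iff_add[of "(n \<otimes> n) \<oplus> n"] by blast
  show ?case
  proof (cases "m = n")
    case False
    with succ have "(m \<otimes> m) \<oplus> m \<prec> n \<otimes> n" by (simp add: less_succ)
    then show ?thesis
      by (rule less_trans[OF _ le_less_trans[OF le_add1 *]])
  qed (use * in simp)
qed (simp add: not_less_zero)

section \<open>Codes of coloured triples\<close>

text \<open>The values of the terms \<^const>\<open>pair\<close> and \<^const>\<open>coloured\<close> in the model.\<close>

definition pr :: "'a \<Rightarrow> 'a \<Rightarrow> 'a" where
  "pr s t = ((s \<oplus> t) \<otimes> (s \<oplus> t)) \<oplus> s"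

definition col :: "'a \<Rightarrow> 'a \<Rightarrow> 'a \<Rightarrow> 'a \<Rightarrow> 'a" where
  "col a b c i = pr (pr a (pr b c)) i"

lemma evalt_coloured:
  "evalt M e (coloured a b c i) = col (evalt M e a) (evalt M e b) (evalt M e c) (evalt M e i)"
  by (simp add: coloured_def pair_def col_def pr_def)

lemma Term_pr: "Term f \<Longrightarrow> Term g \<Longrightarrow> Term (\<lambda>e. pr (f e) (g e))"
  unfolding pr_def by (intro definable)

lemma Term_col:
  "Term f \<Longrightarrow> Term g \<Longrightarrow> Term h \<Longrightarrow> Term k \<Longrightarrow> Term (\<lambda>e. col (f e) (g e) (h e) (k e))"
  unfolding col_def by (intro Term_pr)

text \<open>Components are bounded by their code. Therefore a bounded formula can search for the triple
  that a code stands for.\<close>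

lemma le_pr1: "s \<preceq> pr s t"
  unfolding pr_def by (rule le_add2)

lemma le_pr2: "t \<preceq> pr s t"
proof -
  have "t \<preceq> s \<oplus> t" by (rule le_add2)
  moreover have "s \<oplus> t \<preceq> (s \<oplus> t) \<otimes> (s \<oplus> t)" by (rule le_square)
  moreover have "(s \<oplus> t) \<otimes> (s \<oplus> t) \<preceq> pr s t" unfolding pr_def by (rule le_add1)
  ultimately show ?thesis by (rule le_trans[OF _ le_trans])
qed

lemma pr_less: assumes "s \<oplus> t \<prec> s' \<oplus> t'" shows "pr s t \<prec> pr s' t'"
proof -
  have "pr s t \<preceq> ((s \<oplus> t) \<otimes> (s \<oplus> t)) \<oplus> (s \<oplus> t)"
    unfolding pr_def by (rule add_left_mono[OF le_add1])
  moreover have "((s \<oplus> t) \<otimes> (s \<oplus> t)) \<oplus> (s \<oplus> t) \<prec> (s' \<oplus> t') \<otimes> (s' \<oplus> t')"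
    using assms by (rule square_gap)
  moreover have "(s' \<oplus> t') \<otimes> (s' \<oplus> t') \<preceq> pr s' t'"
    unfolding pr_def by (rule le_add1)
  ultimately show ?thesis by (rule le_less_trans[OF _ less_le_trans])
qed

lemma pr_inject: "pr s t = pr s' t' \<longleftrightarrow> s = s' \<and> t = t'"
proof
  assume eq: "pr s t = pr s' t'"
  then have "s \<oplus> t = s' \<oplus> t'"
    using pr_less[of s t s' t'] pr_less[of s' t' s t] less_linear[of "s \<oplus> t" "s' \<oplus> t'"] less_irrefl
    by auto
  moreover from this eq have "s = s'"
    unfolding pr_def by (simp add: add_left_cancel)
  ultimately show "s = s' \<and> t = t'" by (simp add: add_left_cancel)
qed simp

lemma col_inject: "col a b c i = col a' b' c' i' \<longleftrightarrow> a = a' \<and> b = b' \<and> c = c' \<and> i = i'"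
  by (auto simp: col_def pr_inject)

lemma le_col: "a \<preceq> col a b c i" "b \<preceq> col a b c i" "c \<preceq> col a b c i"
  unfolding col_def
  by (rule le_trans[OF le_pr1 le_pr1] le_trans[OF le_trans[OF le_pr1 le_pr2] le_pr1]
    le_trans[OF le_trans[OF le_pr2 le_pr2] le_pr1])+

section \<open>Ramsey's theorem inside the model\<close>

lemma RT32_sat:
  assumes "sat M e r RT32" "C \<in> sets M"
    and "\<And>p. p \<in> C \<Longrightarrow> \<exists>a b c i. a \<prec> b \<and> b \<prec> c \<and> (i = \<zero> \<or> i = \<one>) \<and> p = col a b c i"
    and "\<And>a b c. a \<prec> b \<Longrightarrow> b \<prec> c \<Longrightarrow> col a b c \<zero> \<in> C \<longleftrightarrow> col a b c \<one> \<notin> C"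
  shows "\<exists>H\<in>sets M. (\<forall>n. \<exists>m. n \<prec> m \<and> m \<in> H) \<and>
    (\<exists>i. \<forall>a b c. a \<in> H \<and> b \<in> H \<and> c \<in> H \<and> a \<prec> b \<and> b \<prec> c \<longrightarrow> col a b c i \<in> C)"
proof -
  have "sat M e (case_nat C r) (colouring 0)"
    using assms(3,4) by (simp add: colouring_def Let_def evalt_coloured One_nat_def)
  then have "sat M e (case_nat C r) (ExS (infinite_set 0 \<^bold>\<and> homogeneous 0 1))"
    using assms(1,2) unfolding RT32_def by simp
  then show ?thesis
    by (simp add: infinite_set_def homogeneous_def Let_def evalt_coloured One_nat_def) blast
qed

text \<open>For a definable relation \<open>K\<close>, the colouring that gives colour 1 to the triples in \<open>K\<close> and
  colour 0 to the others is a set of the model.\<close>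

lemma ramsey:
  assumes "sat M e r RT32" "Delta0 (\<lambda>e. K (e 0) (e 1) (e 2))"
  shows "\<exists>H\<in>sets M. (\<forall>n. \<exists>m\<in>H. n \<prec> m) \<and>
    ((\<forall>a\<in>H. \<forall>b\<in>H. \<forall>c\<in>H. a \<prec> b \<longrightarrow> b \<prec> c \<longrightarrow> K a b c) \<or>
     (\<forall>a\<in>H. \<forall>b\<in>H. \<forall>c\<in>H. a \<prec> b \<longrightarrow> b \<prec> c \<longrightarrow> \<not> K a b c))"
proof -
  define P where "P p \<longleftrightarrow> (\<exists>a. a \<prec> p \<oplus> \<one> \<and> (\<exists>b. b \<prec> p \<oplus> \<one> \<and> (\<exists>c. c \<prec> p \<oplus> \<one> \<and>
    (a \<prec> b \<and> b \<prec> c \<and> (K a b c \<and> p = col a b c \<one> \<or> \<not> K a b c \<and> p = col a b c \<zero>)))))" for p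
  have Pset: "{p. P p} \<in> sets M"
    unfolding P_def by (intro Delta0_set definable Term_col Delta0_ternary[where K = K, OF assms(2)])
  have ne: "\<zero> \<noteq> \<one>"
    using succ_ne_zero[of \<zero>] by (simp add: zero_add)
  have P_iff: "P p \<longleftrightarrow> (\<exists>a b c. a \<prec> b \<and> b \<prec> c \<and>
    (K a b c \<and> p = col a b c \<one> \<or> \<not> K a b c \<and> p = col a b c \<zero>))" for p
  proof
    assume "\<exists>a b c. a \<prec> b \<and> b \<prec> c \<and>
      (K a b c \<and> p = col a b c \<one> \<or> \<not> K a b c \<and> p = col a b c \<zero>)"
    then obtain a b c where abc: "a \<prec> b" "b \<prec> c"
      "K a b c \<and> p = col a b c \<one> \<or> \<not> K a b c \<and> p = col a b c \<zero>" by blast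
    then have "a \<prec> p \<oplus> \<one>" "b \<prec> p \<oplus> \<one>" "c \<prec> p \<oplus> \<one>"
      unfolding less_succ using le_col by blast+
    with abc show "P p" unfolding P_def by blast
  qed (unfold P_def, blast)
  have K: "P (col a b c i) \<longleftrightarrow> i = \<one> \<and> K a b c \<or> i = \<zero> \<and> \<not> K a b c" if "a \<prec> b" "b \<prec> c" for a b c i
    using that unfolding P_iff col_inject by blast
  have P: "\<exists>a b c i. a \<prec> b \<and> b \<prec> c \<and> (i = \<zero> \<or> i = \<one>) \<and> p = col a b c i" if "P p" for p
    using that unfolding P_iff by blast
  have two: "P (col a b c \<zero>) \<longleftrightarrow> \<not> P (col a b c \<one>)" if "a \<prec> b" "b \<prec> c" for a b c
    using that ne by (simp add: K)
  have "\<exists>H\<in>sets M. (\<forall>n. \<exists>m. n \<prec> m \<and> m \<in> H) \<and>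
    (\<exists>i. \<forall>a b c. a \<in> H \<and> b \<in> H \<and> c \<in> H \<and> a \<prec> b \<and> b \<prec> c \<longrightarrow> col a b c i \<in> {p. P p})"
    using Pset by (rule RT32_sat[OF assms(1)]) (unfold mem_Collect_eq, (rule P two, assumption+)+)
  then obtain H i where H: "H \<in> sets M" "\<And>n. \<exists>m. n \<prec> m \<and> m \<in> H"
    "\<And>a b c. a \<in> H \<Longrightarrow> b \<in> H \<Longrightarrow> c \<in> H \<Longrightarrow> a \<prec> b \<Longrightarrow> b \<prec> c \<Longrightarrow> P (col a b c i)"
    by blast
  show ?thesis
  proof (intro bexI[OF _ H(1)] conjI)
    show "\<forall>n. \<exists>m\<in>H. n \<prec> m" using H(2) by blast
    show "(\<forall>a\<in>H. \<forall>b\<in>H. \<forall>c\<in>H. a \<prec> b \<longrightarrow> b \<prec> c \<longrightarrow> K a b c) \<or>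
      (\<forall>a\<in>H. \<forall>b\<in>H. \<forall>c\<in>H. a \<prec> b \<longrightarrow> b \<prec> c \<longrightarrow> \<not> K a b c)"
    proof (cases "i = \<one>")
      case True
      have "K a b c" if "a \<in> H" "b \<in> H" "c \<in> H" "a \<prec> b" "b \<prec> c" for a b c
        using H(3)[OF that] unfolding K[OF that(4,5)] by (simp add: True ne[symmetric])
      then show ?thesis by blast
    next
      case False
      have "\<not> K a b c" if "a \<in> H" "b \<in> H" "c \<in> H" "a \<prec> b" "b \<prec> c" for a b c
        using H(3)[OF that] unfolding K[OF that(4,5)] by (simp add: False)
      then show ?thesis by blast
    qed
  qed
qed

text \<open>The least number principle for \<open>\<exists>y. Q n y\<close>. Failing it, one can descend \<open>j\<close> steps from \<open>n\<close>
  for every \<open>j\<close>, by induction on \<open>j\<close>; but not \<open>n + 1\<close> steps. The descent stays below \<open>n\<close>, which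
  leaves only one unbounded quantifier in the induction formula.\<close>

lemma least_witnessed:
  assumes "Delta0 (\<lambda>e. Q (e 0) (e 1))" "Q n y"
  shows "\<exists>m z. Q m z \<and> (\<forall>k z. k \<prec> m \<longrightarrow> \<not> Q k z)"
proof (rule ccontr)
  assume "\<not> ?thesis"
  then have descent: "\<exists>k z. k \<prec> m \<and> Q k z" if "Q m w" for m w
    using that by blast
  have "\<exists>z. \<exists>m. m \<prec> n \<oplus> \<one> \<and> (Q m z \<and> m \<oplus> j \<prec> n \<oplus> \<one>)" for j
  proof (induction j rule: Sigma1_induct)
    show "Sigma1 (\<lambda>e. \<exists>z. \<exists>m. m \<prec> n \<oplus> \<one> \<and> (Q m z \<and> m \<oplus> e 0 \<prec> n \<oplus> \<one>))"
      by (rule Sigma1_ex) (intro definable Delta0_binary[where K = Q, OF assms(1)])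
  next
    case zero
    show ?case using assms(2) by (auto simp: add_zero less_succ)
  next
    case (succ j)
    then obtain m z where mz: "Q m z" "m \<oplus> j \<prec> n \<oplus> \<one>" "m \<prec> n \<oplus> \<one>" by blast
    obtain k w where kw: "k \<prec> m" "Q k w" using descent[OF mz(1)] by blast
    have "j \<oplus> (k \<oplus> \<one>) \<preceq> j \<oplus> m"
      using kw(1) by (intro add_left_mono succ_le)
    then have "k \<oplus> (j \<oplus> \<one>) \<preceq> m \<oplus> j"
      by (simp only: add_commute add_left_commute)
    then have "k \<oplus> (j \<oplus> \<one>) \<prec> n \<oplus> \<one>"
      using mz(2) by (rule le_less_trans)
    moreover have "k \<prec> n \<oplus> \<one>"
      using kw(1) mz(3) by (rule less_trans)
    ultimately show ?case using kw(2) by blast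
  qed
  then obtain m where "m \<oplus> (n \<oplus> \<one>) \<prec> n \<oplus> \<one>" by blast
  with le_less_trans[OF le_add2] show False
    using less_irrefl by blast
qed

section \<open>Sigma-1 comprehension from Ramsey's theorem\<close>

text \<open>In terms of the numbers \<open>d x y\<close> of the introduction, \<open>New n x y\<close> holds for the candidates of
  which \<open>d x y\<close> is the least, and \<open>K x y z\<close> says \<open>d y z < d x y\<close>.\<close>

theorem Sigma1_comprehension:
  assumes RT: "sat M e r RT32" and \<theta>: "Delta0 (\<lambda>e. \<theta> (e 0) (e 1))"
  shows "{n. \<exists>s. \<theta> s n} \<in> sets M"
proof -
  define E where "E t n \<longleftrightarrow> n \<prec> t \<and> (\<exists>s. s \<prec> t \<and> \<theta> s n)" for t n
  define New where "New n x y \<longleftrightarrow> E y n \<and> \<not> E x n" for n x y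
  define K where "K x y z \<longleftrightarrow> (\<exists>n. n \<prec> z \<and> (New n y z \<and> (\<forall>m. m \<prec> n \<oplus> \<one> \<longrightarrow> \<not> New m x y)))"
    for x y z
  have E: "Delta0 (\<lambda>e. E (e 0) (e 1))"
    unfolding E_def by (intro definable Delta0_binary[where K = \<theta>, OF \<theta>])
  have New: "Delta0 (\<lambda>e. New (e 0) (e 1) (e 2))"
    unfolding New_def by (intro definable Delta0_binary[where K = E, OF E])
  have K: "Delta0 (\<lambda>e. K (e 0) (e 1) (e 2))"
    unfolding K_def by (intro definable Delta0_ternary[where K = New, OF New])
  obtain G where G: "G \<in> sets M" "\<And>n. \<exists>m\<in>G. n \<prec> m" and hom:
    "(\<forall>x\<in>G. \<forall>y\<in>G. \<forall>z\<in>G. x \<prec> y \<longrightarrow> y \<prec> z \<longrightarrow> K x y z) \<or>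
     (\<forall>x\<in>G. \<forall>y\<in>G. \<forall>z\<in>G. x \<prec> y \<longrightarrow> y \<prec> z \<longrightarrow> \<not> K x y z)"
    using ramsey[where K = K, OF RT K] by blast
  from hom have notK: "\<not> K x y z" if xyz: "x \<in> G" "y \<in> G" "z \<in> G" "x \<prec> y" "y \<prec> z" for x y z
  proof
    assume K: "\<forall>x\<in>G. \<forall>y\<in>G. \<forall>z\<in>G. x \<prec> y \<longrightarrow> y \<prec> z \<longrightarrow> K x y z"
    define Q where "Q n y \<longleftrightarrow> y \<in> G \<and> (\<exists>x. x \<prec> y \<and> (x \<in> G \<and> New n x y))" for n y
    have Q: "Delta0 (\<lambda>e. Q (e 0) (e 1))"
      unfolding Q_def by (intro definable G(1) Delta0_ternary[where K = New, OF New])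
    \<comment> \<open>Some value of \<open>d\<close> on \<open>G\<close> is finite, and there would be another one below the least.\<close>
    have "K x y z" using K xyz by blast
    then obtain n where "Q n z"
      unfolding K_def Q_def using xyz by blast
    then obtain m y where m: "Q m y" "\<And>k z. k \<prec> m \<Longrightarrow> \<not> Q k z"
      using least_witnessed[where Q = Q, OF Q] by blast
    then obtain x where x: "x \<prec> y" "x \<in> G" "y \<in> G" "New m x y"
      unfolding Q_def by blast
    obtain z where z: "z \<in> G" "y \<prec> z" using G(2) by blast
    have "K x y z" using K x z by blast
    then obtain k where k: "New k y z" "\<And>m. m \<prec> k \<oplus> \<one> \<Longrightarrow> \<not> New m x y"
      unfolding K_def by blast
    have "Q k z" unfolding Q_def using k x z by blast
    with m(2) have "m \<prec> k \<oplus> \<one>" using less_linear less_succ by blast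
    with k(2) x(4) show ?thesis by blast
  qed (use xyz in blast)
  have earlier: "\<exists>m. m \<preceq> n \<and> New m x y"
    if "x \<in> G" "y \<in> G" "z \<in> G" "x \<prec> y" "y \<prec> z" "New n y z" for x y z n
  proof -
    have "n \<prec> z" using that(6) unfolding New_def E_def by blast
    then show ?thesis
      using notK[OF that(1-5)] that(6) unfolding K_def less_succ by blast
  qed
  \<comment> \<open>There are \<open>x < y\<close> in \<open>G\<close> with \<open>d x y \<ge> k\<close>, because \<open>d\<close> increases strictly along \<open>G\<close>.\<close>
  have quiet: "\<exists>y. y \<in> G \<and> (\<exists>x. x \<prec> y \<and> (x \<in> G \<and> (\<forall>n. n \<prec> k \<longrightarrow> \<not> New n x y)))" for k
  proof (induction k rule: Sigma1_induct)
    show "Sigma1 (\<lambda>e. \<exists>y. y \<in> G \<and> (\<exists>x. x \<prec> y \<and> (x \<in> G \<and> (\<forall>n. n \<prec> e 0 \<longrightarrow> \<not> New n x y))))"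
      by (rule Sigma1_ex) (intro definable G(1) Delta0_ternary[where K = New, OF New])
  next
    case zero
    show ?case using G(2) not_less_zero by metis
  next
    case (succ k)
    then obtain x y where xy: "x \<in> G" "y \<in> G" "x \<prec> y" "\<And>n. n \<prec> k \<Longrightarrow> \<not> New n x y" by blast
    obtain z where z: "z \<in> G" "y \<prec> z" using G(2) by blast
    have "\<not> New n y z" if "n \<prec> k \<oplus> \<one>" for n
    proof
      assume New: "New n y z"
      then obtain m where m: "m \<preceq> n" "New m x y"
        using earlier[OF xy(1,2) z(1) xy(3) z(2)] by blast
      then have "m = n" using that xy(4) less_succ less_trans by blast
      with m(2) New show False unfolding New_def by blast
    qed
    with xy z show ?case by blast
  qed
  \<comment> \<open>If \<open>d x y > n\<close>, then \<open>n\<close> is not enumerated for the first time after stage \<open>y\<close>.\<close>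
  have decided: "E y n \<longleftrightarrow> (\<exists>s. \<theta> s n)"
    if "x \<in> G" "y \<in> G" "x \<prec> y" "\<And>m. m \<prec> n \<oplus> \<one> \<Longrightarrow> \<not> New m x y" for x y n
  proof
    assume "\<exists>s. \<theta> s n"
    then obtain s where s: "\<theta> s n" ..
    obtain z1 where z1: "z1 \<in> G" "y \<prec> z1" using G(2) by blast
    obtain z2 where z2: "z2 \<in> G" "(z1 \<oplus> n) \<oplus> s \<prec> z2" using G(2) by blast
    have "z1 \<prec> z2" "n \<prec> z2" "s \<prec> z2"
      by (rule le_less_trans[OF _ z2(2)], rule le_add2 le_trans[OF le_add1 le_add1]
        le_trans[OF le_add2 le_add1])+
    then have "E z2 n" "y \<prec> z2"
      using s z1(2) less_trans unfolding E_def by blast+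
    then show "E y n"
      using earlier[OF that(1,2) z2(1) that(3), of n] that(4) unfolding New_def
      by (auto simp: less_succ)
  qed (auto simp: E_def)
  show ?thesis
  proof (rule Delta1_comprehension)
    show "Sigma1 (\<lambda>e. \<exists>s. \<theta> s (e 0))"
      by (rule Sigma1_ex) (intro definable Delta0_binary[where K = \<theta>, OF \<theta>])
    have "\<not> (\<exists>s. \<theta> s n) \<longleftrightarrow> (\<exists>y. y \<in> G \<and> (\<exists>x. x \<prec> y \<and> (x \<in> G \<and>
      ((\<forall>m. m \<prec> n \<oplus> \<one> \<longrightarrow> \<not> New m x y) \<and> \<not> E y n))))" for n
      using quiet[of "n \<oplus> \<one>"] decided[of _ _ n] by blast
    moreover have "Sigma1 (\<lambda>e. \<exists>y. y \<in> G \<and> (\<exists>x. x \<prec> y \<and> (x \<in> G \<and>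
      ((\<forall>m. m \<prec> e 0 \<oplus> \<one> \<longrightarrow> \<not> New m x y) \<and> \<not> E y (e 0)))))"
      by (rule Sigma1_ex)
        (intro definable G(1) Delta0_ternary[where K = New, OF New] Delta0_binary[where K = E, OF E])
    ultimately show "Sigma1 (\<lambda>e. \<not> (\<exists>s. \<theta> s (e 0)))" by simp
  qed
qed

end

section \<open>The Turing jump\<close>

lemma bounded_BExs: "bounded \<phi> \<Longrightarrow> bounded (BExs m t \<phi>)"
  by (induction m arbitrary: t) (simp_all add: bounded.intros)

lemma halts_Sigma01: "\<exists>\<theta>. halts X t = Ex \<theta> \<and> bounded \<theta>"
  unfolding halts_def Let_def step_def label_def reg_def instruction_def beta_def
  by (intro exI conjI, rule refl) (intro bounded_BExs bounded.intros)

lemma subst_BExs: "subst Var \<rho> (BExs m t \<phi>) = BExs m t (subst Var \<rho> \<phi>)"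
  by (induction m arbitrary: t) (simp_all add: subst_BEx)

text \<open>The oracle is the only set variable, so identifying all set variables with it changes
  nothing. Hence the set that is to become the jump does not influence halting.\<close>

lemma subst_halts: "subst Var (\<lambda>_. X) (halts X t) = halts X t"
  by (simp add: halts_def Let_def step_def label_def reg_def instruction_def beta_def
      subst_BExs subst_BAll subst_BEx)

lemma sat_halts: "sat M e r (halts X t) \<longleftrightarrow> sat M e (\<lambda>_. r X) (halts X t)"
  using sat_subst[of M e r Var "\<lambda>_. X" "halts X t"] by (simp add: subst_halts)

lemma (in RCA0_model) jump_exists:
  assumes "sat M e r RT32"
  shows "sat M e r ACA"
proof -
  obtain \<theta> where \<theta>: "halts 1 (Var 0) = Ex \<theta>" "bounded \<theta>"
    using halts_Sigma01 by blast
  have "\<exists>Y\<in>sets M. sat M e (case_nat Y (case_nat X r)) (is_jump 0 1)" if "X \<in> sets M" for X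
  proof -
    define R where "R s n \<longleftrightarrow> sat M (case_nat s (case_nat n e)) (\<lambda>_. X) \<theta>" for s n
    have "Delta0 (\<lambda>v. sat M (\<lambda>i. case_nat (\<lambda>v. v 0) (case_nat (\<lambda>v. v 1) (\<lambda>i v. e i)) i v) (\<lambda>_. X) \<theta>)"
      using \<theta>(2) by (rule Delta0_sat) (auto intro: Term_var Term_const that split: nat.split)
    moreover have "(\<lambda>i. case_nat (\<lambda>v. v 0) (case_nat (\<lambda>v. v 1) (\<lambda>i v. e i)) i v) =
      case_nat (v 0) (case_nat (v 1) e)" for v :: "nat \<Rightarrow> 'a"
      by (rule ext) (simp split: nat.split)
    ultimately have "Delta0 (\<lambda>v. R (v 0) (v 1))"
      by (simp add: R_def)
    with assms have "{n. \<exists>s. R s n} \<in> sets M"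
      by (rule Sigma1_comprehension)
    moreover have "sat M (case_nat n e) (case_nat Y (case_nat X r)) (halts 1 (Var 0)) \<longleftrightarrow>
      (\<exists>s. R s n)" for n Y
      by (subst sat_halts) (simp add: \<theta>(1)[unfolded One_nat_def] R_def One_nat_def)
    ultimately show ?thesis
      by (intro bexI[of _ "{n. \<exists>s. R s n}"]) (simp_all add: is_jump_def)
  qed
  then show ?thesis by (simp add: ACA_def)
qed

theorem corollary1:
  shows "RCA0 \<turnstile> RT32 \<^bold>\<longrightarrow> ACA"
proof (rule ccontr)
  assume "\<not> (RCA0 \<turnstile> RT32 \<^bold>\<longrightarrow> ACA)"
  then obtain M :: "nat L2_structure" and S :: "nat \<Rightarrow> nat set" and e r where
    M: "sets M = range S" "\<And>\<psi> e r. \<psi> \<in> RCA0 \<Longrightarrow> range r \<subseteq> sets M \<Longrightarrow> sat M e r \<psi>"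
    and "\<not> sat M e r (RT32 \<^bold>\<longrightarrow> ACA)"
    by (rule countable_model[rotated]) (auto simp: RCA0_def)
  interpret RCA0_model M id S
    by unfold_locales (use M in auto)
  show False
    using jump_exists \<open>\<not> sat M e r (RT32 \<^bold>\<longrightarrow> ACA)\<close> by simp
qed

end
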